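(* Let $S$ be a semitopological semigroup (with neutral element). (1) Every weakly continuous representation $(h,\alpha)$ of an $S$-space $X$ on a Rosenthal Banach space is $E$-compatible. (2) If the representation in (1) is $w^*$-generating then the representation is strongly $E$-compatible.
   Context: Spaces are Hausdorff, Banach spaces real. $S$ is a monoid with separately continuous multiplication. An $S$-space is a (not necessarily compact) topological space $X$ with a separately continuous monoidal action $S\times X\to X$. A Banach space is Rosenthal if it contains no isomorphic copy of $l_1$. $\Theta(V)$ is the semigroup of linear operators on $V$ with norm $\le1$. A weakly continuous representation of $(S,X)$ on $V$ is a pair $(h,\alpha)$ where $h:S\to\Theta(V)$ is a co-homomorphism ($h(st)=h(t)h(s)$, $h(e)=\mathrm{id}$) continuous for the weak operator topology, and $\alpha:X\to V^*$ is a weak$^*$ continuous bounded $S$-map for the dual action $(s\varphi)(v)=\varphi(h(s)v)$ on $V^*$. Put $Y:=\overline{\alpha(X)}^{w^*}$, $Q:=\overline{co}^{w^*}(\alpha(X))$ and let $B^*$ be the unit ball of $V^*$; with the weak$^*$ topology these are compact spaces with separately continuous $S$-actions, and $Y\subset Q\subset rB^*$ for some $r>0$. The enveloping semigroup $E(K)$ of a compact $S$-space $K$ is the pointwise closure in $K^K$ of the translations $x\mapsto sx$. Restriction of maps gives continuous surjective homomorphisms $E(B^* )\cong E(rB^* )\to E(Q)\to E(Y)$. The representation is $E$-compatible if $E(Q)\to E(Y)$ is an isomorphism (equivalently injective), and strongly $E$-compatible if the composition $E(B^* )\to E(Y)$ is an isomorphism. It is $w^*$-generating if the linear span of $\overline{co}^{w^*}(\alpha(X))$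 is norm dense in $V^*$. *)

theory Defs
  imports "HOL-Analysis.Analysis"
begin

section \<open>Semitopological monoids and their actions\<close>

class semitopological_monoid = monoid_mult + t2_space +
  assumes open_vimage_mult_left: "open U \<Longrightarrow> open ((\<lambda>t. s * t) -` U)"
    and open_vimage_mult_right: "open U \<Longrightarrow> open ((\<lambda>t. t * s) -` U)"

definition S_space :: "('s::semitopological_monoid \<Rightarrow> 'x \<Rightarrow> 'x) \<Rightarrow> 'x topology \<Rightarrow> bool" where
  "S_space act X \<longleftrightarrow>
     Hausdorff_space X \<and>
     (\<forall>x\<in>topspace X. act 1 x = x) \<and>
     (\<forall>s t. \<forall>x\<in>topspace X. act (s * t) x = act s (act t x)) \<and>
     (\<forall>s. continuous_map X X (act s)) \<and>
     (\<forall>x\<in>topspace X. continuous_map euclidean X (\<lambda>s. act s x))"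

section \<open>Enveloping semigroups\<close>

text \<open>Self-maps of the carrier of \<open>K\<close> are represented by extensional functions
  (value \<^const>\<open>undefined\<close> off the carrier), and are multiplied by \<^const>\<open>compose\<close>.\<close>

definition enveloping_semigroup :: "('s \<Rightarrow> 'k \<Rightarrow> 'k) \<Rightarrow> 'k topology \<Rightarrow> ('k \<Rightarrow> 'k) set" where
  "enveloping_semigroup act K =
     product_topology (\<lambda>_. K) (topspace K) closure_of
       range (\<lambda>s. restrict (act s) (topspace K))"

definition enveloping_topology :: "('s \<Rightarrow> 'k \<Rightarrow> 'k) \<Rightarrow> 'k topology \<Rightarrow> ('k \<Rightarrow> 'k) topology" where
  "enveloping_topology act K =
     subtopology (product_topology (\<lambda>_. K) (topspace K)) (enveloping_semigroup act K)"

definition enveloping_iso ::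
  "('s \<Rightarrow> 'k \<Rightarrow> 'k) \<Rightarrow> 'k topology \<Rightarrow> 'k topology \<Rightarrow> (('k \<Rightarrow> 'k) \<Rightarrow> ('k \<Rightarrow> 'k)) \<Rightarrow> bool" where
  "enveloping_iso act K L f \<longleftrightarrow>
     homeomorphic_map (enveloping_topology act K) (enveloping_topology act L) f \<and>
     (\<forall>p\<in>enveloping_semigroup act K. \<forall>q\<in>enveloping_semigroup act K.
        f (compose (topspace K) p q) = compose (topspace L) (f p) (f q))"

section \<open>Rosenthal Banach spaces\<close>

text \<open>An isomorphic copy of \<open>l\<^sub>1\<close> in \<open>V\<close> is the image of a linear map on the absolutely summable
  real sequences that is bounded and bounded below for the \<open>l\<^sub>1\<close>-norm. Function types carry no
  vector space structure in the library, so linearity is written pointwise.\<close>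

definition l1_seqs :: "(nat \<Rightarrow> real) set" where
  "l1_seqs = {a. summable (\<lambda>n. \<bar>a n\<bar>)}"

definition l1_norm :: "(nat \<Rightarrow> real) \<Rightarrow> real" where
  "l1_norm a = (\<Sum>n. \<bar>a n\<bar>)"

definition l1_embedding :: "((nat \<Rightarrow> real) \<Rightarrow> 'v::real_normed_vector) \<Rightarrow> bool" where
  "l1_embedding T \<longleftrightarrow>
     (\<forall>a\<in>l1_seqs. \<forall>b\<in>l1_seqs. T (\<lambda>n. a n + b n) = T a + T b) \<and>
     (\<forall>c. \<forall>a\<in>l1_seqs. T (\<lambda>n. c * a n) = c *\<^sub>R T a) \<and>
     (\<exists>m>0. \<exists>M. \<forall>a\<in>l1_seqs. m * l1_norm a \<le> norm (T a) \<and> norm (T a) \<le> M * l1_norm a)"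

definition rosenthal_space :: "'v::banach itself \<Rightarrow> bool" where
  "rosenthal_space _ \<longleftrightarrow> (\<nexists>T :: (nat \<Rightarrow> real) \<Rightarrow> 'v. l1_embedding T)"

section \<open>Representations on Banach spaces\<close>

definition weak_star_topology :: "('v::real_normed_vector \<Rightarrow>\<^sub>L real) topology" where
  "weak_star_topology = pullback_topology UNIV blinfun_apply euclidean"

definition weak_operator_topology :: "('v::real_normed_vector \<Rightarrow>\<^sub>L 'v) topology" where
  "weak_operator_topology =
     pullback_topology UNIV (\<lambda>A v (\<phi> :: 'v \<Rightarrow>\<^sub>L real). blinfun_apply \<phi> (blinfun_apply A v)) euclidean"

definition Theta :: "('v::real_normed_vector \<Rightarrow>\<^sub>L 'v) set" where
  "Theta = {A. norm A \<le> 1}"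

definition dual_action ::
  "('s \<Rightarrow> ('v::real_normed_vector \<Rightarrow>\<^sub>L 'v)) \<Rightarrow> 's \<Rightarrow> ('v \<Rightarrow>\<^sub>L real) \<Rightarrow> ('v \<Rightarrow>\<^sub>L real)" where
  "dual_action h s \<phi> = \<phi> o\<^sub>L h s"

definition weakly_continuous_representation ::
  "('s::semitopological_monoid \<Rightarrow> 'x \<Rightarrow> 'x) \<Rightarrow> 'x topology \<Rightarrow>
   ('s \<Rightarrow> ('v::banach \<Rightarrow>\<^sub>L 'v)) \<Rightarrow> ('x \<Rightarrow> ('v \<Rightarrow>\<^sub>L real)) \<Rightarrow> bool" where
  "weakly_continuous_representation act X h \<alpha> \<longleftrightarrow>
     h 1 = id_blinfun \<and>
     (\<forall>s t. h (s * t) = h t o\<^sub>L h s) \<and>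
     continuous_map euclidean (subtopology weak_operator_topology Theta) h \<and>
     continuous_map X weak_star_topology \<alpha> \<and>
     bounded (\<alpha> ` topspace X) \<and>
     (\<forall>s. \<forall>x\<in>topspace X. \<alpha> (act s x) = dual_action h s (\<alpha> x))"

definition rep_Y :: "'x topology \<Rightarrow> ('x \<Rightarrow> ('v::banach \<Rightarrow>\<^sub>L real)) \<Rightarrow> ('v \<Rightarrow>\<^sub>L real) set" where
  "rep_Y X \<alpha> = weak_star_topology closure_of (\<alpha> ` topspace X)"

definition rep_Q :: "'x topology \<Rightarrow> ('x \<Rightarrow> ('v::banach \<Rightarrow>\<^sub>L real)) \<Rightarrow> ('v \<Rightarrow>\<^sub>L real) set" where
  "rep_Q X \<alpha> = weak_star_topology closure_of (convex hull (\<alpha> ` topspace X))"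

definition w_star_generating :: "'x topology \<Rightarrow> ('x \<Rightarrow> ('v::banach \<Rightarrow>\<^sub>L real)) \<Rightarrow> bool" where
  "w_star_generating X \<alpha> \<longleftrightarrow> closure (span (rep_Q X \<alpha>)) = UNIV"

definition E_compatible ::
  "'x topology \<Rightarrow> ('s \<Rightarrow> ('v::banach \<Rightarrow>\<^sub>L 'v)) \<Rightarrow> ('x \<Rightarrow> ('v \<Rightarrow>\<^sub>L real)) \<Rightarrow> bool" where
  "E_compatible X h \<alpha> \<longleftrightarrow>
     enveloping_iso (dual_action h)
       (subtopology weak_star_topology (rep_Q X \<alpha>))
       (subtopology weak_star_topology (rep_Y X \<alpha>))
       (\<lambda>p. restrict p (rep_Y X \<alpha>))"

text \<open>The canonical identification of \<open>E(B\<^sup>*)\<close> with \<open>E(rB\<^sup>*)\<close>, induced by the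
  equivariant homeomorphism \<open>x \<mapsto> r x\<close>.\<close>

definition dilate :: "real \<Rightarrow> ('a::real_normed_vector \<Rightarrow> 'a) \<Rightarrow> ('a \<Rightarrow> 'a)" where
  "dilate r p = (\<lambda>x\<in>cball 0 r. r *\<^sub>R p (x /\<^sub>R r))"

text \<open>The composition \<open>E(B\<^sup>*) \<cong> E(rB\<^sup>*) \<rightarrow> E(Q) \<rightarrow> E(Y)\<close> does not depend on
  the choice of \<open>r > 0\<close> with \<open>Q \<subseteq> rB\<^sup>*\<close>; such an \<open>r\<close> exists for every representation.\<close>

definition strongly_E_compatible ::
  "'x topology \<Rightarrow> ('s \<Rightarrow> ('v::banach \<Rightarrow>\<^sub>L 'v)) \<Rightarrow> ('x \<Rightarrow> ('v \<Rightarrow>\<^sub>L real)) \<Rightarrow> bool" where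
  "strongly_E_compatible X h \<alpha> \<longleftrightarrow>
     (\<exists>r>0. rep_Q X \<alpha> \<subseteq> cball 0 r) \<and>
     (\<forall>r>0. rep_Q X \<alpha> \<subseteq> cball 0 r \<longrightarrow>
        enveloping_iso (dual_action h)
          (subtopology weak_star_topology (cball 0 1))
          (subtopology weak_star_topology (rep_Y X \<alpha>))
          ((\<lambda>p. restrict p (rep_Y X \<alpha>)) \<circ> (\<lambda>p. restrict p (rep_Q X \<alpha>)) \<circ> dilate r))"

end

theory Submission
  imports Defs
begin

text \<open>
  \<^bold>\<open>Why the theorem holds.\<close>  An element \<open>p\<close> of an enveloping semigroup inside \<open>V\<^sup>*\<close> is a pointwise limit
  of operators dual to contractions, so for two such elements \<open>p\<close>, \<open>q\<close> and a vector \<open>v\<close> the function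
  \<open>f \<phi> = p \<phi> v - q \<phi> v\<close> is the restriction of an element of the bidual: on each finite set it is
  approximated by evaluations at vectors from one fixed ball of \<open>V\<close>
  (\<open>bidual_on_enveloping_difference\<close>).  Restriction to \<open>Y\<close> is injective as soon as such an \<open>f\<close> vanishes
  on \<open>Q\<close>, the weak-star closed convex hull of \<open>Y\<close>, whenever it vanishes on \<open>Y\<close>.  This is Haydon's
  theorem, that in the dual of a Rosenthal space the weak-star and the norm closed convex hulls of a
  weak-star compact set agree, in the form \<open>bidual_vanishes_on_closed_convex_hull\<close>.  When the span of
  \<open>Q\<close> is norm dense, boundedness of the approximating vectors carries the vanishing from \<open>Q\<close> on to
  every ball (\<open>bidual_vanishes_on_closed_span\<close>), which gives the second part.  An injective
  restriction map between enveloping semigroups is then an isomorphism by compactness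
  (\<open>enveloping_iso_of_injective\<close>).

  \<^bold>\<open>Why Haydon's theorem holds.\<close>  Suppose that \<open>f\<close> vanishes on \<open>Y\<close> and \<open>f \<phi> \<noteq> 0\<close> for some \<open>\<phi> \<in> Q\<close>.
  Represent \<open>\<phi>\<close> by a finitely additive mean \<open>m\<close> on \<open>Y\<close>.  Some bounded convex set of
  vectors then has all its \<open>m\<close>-integrals above a constant \<open>c > 0\<close>, although it contains vectors that
  are as small as desired on any given finite part of \<open>Y\<close>.  The elements of almost minimal
  \<open>L\<^sup>2(m)\<close>-norm subject to these smallness conditions form a filter that is Cauchy for that norm, by the
  parallelogram law (\<open>Cauchy_filter_of_convex_family\<close>).  Late vectors in it are therefore
  close to each other in the mean and above \<open>c / 2\<close> on a part of \<open>Y\<close> that is not negligible, and yet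
  each point of \<open>Y\<close> has a neighbourhood on which some late vector is small.  Hence a single vector
  splits any finite number of non-negligible compact sets into a part where it is at least \<open>c / 3\<close> and a
  part where it is at most \<open>c / 4\<close>, both again non-negligible
  (\<open>simultaneous_splitting\<close>).  Iterating this yields an independent
  sequence, and independent bounded sequences span \<open>l\<^sub>1\<close> (\<open>l1_embedding_of_independent\<close>).
\<close>

section \<open>Means on bounded functions\<close>

text \<open>A mean is integration against a finitely additive probability defined on all subsets of \<open>Y\<close>.  It
  stands in for a representing measure: arbitrary cut-offs of functions can be integrated, and a
  prescribed barycentre can be attained by a compactness argument.  Values on functions that are
  unbounded on \<open>Y\<close> carry no meaning.\<close>

definition mean_on :: "'y set \<Rightarrow> (('y \<Rightarrow> real) \<Rightarrow> real) \<Rightarrow> bool" where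
  "mean_on Y m \<longleftrightarrow>
     (\<forall>f g. bounded (f ` Y) \<longrightarrow> bounded (g ` Y) \<longrightarrow> m (\<lambda>y. f y + g y) = m f + m g) \<and>
     (\<forall>c f. bounded (f ` Y) \<longrightarrow> m (\<lambda>y. c * f y) = c * m f) \<and>
     (\<forall>f b. bounded (f ` Y) \<longrightarrow> (\<forall>y\<in>Y. f y \<le> b) \<longrightarrow> m f \<le> b)"

lemma mean_onD:
  assumes "mean_on Y m" "bounded (f ` Y)"
  shows mean_add: "bounded (g ` Y) \<Longrightarrow> m (\<lambda>y. f y + g y) = m f + m g"
    and mean_scale: "m (\<lambda>y. c * f y) = c * m f"
    and mean_le: "(\<And>y. y \<in> Y \<Longrightarrow> f y \<le> b) \<Longrightarrow> m f \<le> b"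
  using assms unfolding mean_on_def by blast+

lemma bounded_realI: "(\<And>y. y \<in> Y \<Longrightarrow> \<bar>f y\<bar> \<le> (b::real)) \<Longrightarrow> bounded (f ` Y)"
  unfolding bounded_iff by auto

lemma bounded_pointwise:
  fixes f g :: "'y \<Rightarrow> real"
  assumes "bounded (f ` Y)"
  shows bounded_pointwise_add: "bounded (g ` Y) \<Longrightarrow> bounded ((\<lambda>y. f y + g y) ` Y)"
    and bounded_pointwise_diff: "bounded (g ` Y) \<Longrightarrow> bounded ((\<lambda>y. f y - g y) ` Y)"
    and bounded_pointwise_scale: "bounded ((\<lambda>y. c * f y) ` Y)"
    and bounded_pointwise_square: "bounded ((\<lambda>y. (f y)\<^sup>2) ` Y)"
proof -
  obtain a where a: "\<And>y. y \<in> Y \<Longrightarrow> \<bar>f y\<bar> \<le> a"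
    using assms unfolding bounded_iff by auto
  show "bounded ((\<lambda>y. c * f y) ` Y)"
    by (rule bounded_realI[where b = "\<bar>c\<bar> * a"]) (auto simp: abs_mult intro!: mult_left_mono a)
  show "bounded ((\<lambda>y. (f y)\<^sup>2) ` Y)"
    by (rule bounded_realI[where b = "a\<^sup>2"]) (metis a abs_power2 abs_le_square_iff abs_abs abs_ge_self order_trans)
  assume "bounded (g ` Y)"
  then obtain b where b: "\<And>y. y \<in> Y \<Longrightarrow> \<bar>g y\<bar> \<le> b"
    unfolding bounded_iff by auto
  show "bounded ((\<lambda>y. f y + g y) ` Y)"
    by (rule bounded_realI[where b = "a + b"]) (use a b in \<open>fastforce\<close>)
  show "bounded ((\<lambda>y. f y - g y) ` Y)"
    by (rule bounded_realI[where b = "a + b"]) (use a b in \<open>fastforce\<close>)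
qed

lemma mean_diff:
  assumes "mean_on Y m" "bounded (f ` Y)" "bounded (g ` Y)"
  shows "m (\<lambda>y. f y - g y) = m f - m g"
  using mean_add[OF assms(1,2) bounded_pointwise_scale[OF assms(3), of "-1"]]
    mean_scale[OF assms(1,3), of "-1"] by simp

lemma mean_mono:
  assumes "mean_on Y m" "bounded (f ` Y)" "bounded (g ` Y)" "\<And>y. y \<in> Y \<Longrightarrow> f y \<le> g y"
  shows "m f \<le> m g"
  using mean_le[OF assms(1) bounded_pointwise_diff[OF assms(2,3)], of 0] mean_diff[OF assms(1-3)] assms(4)
  by simp

lemma mean_ge:
  assumes "mean_on Y m" "bounded (f ` Y)" "\<And>y. y \<in> Y \<Longrightarrow> b \<le> f y"
  shows "b \<le> m f"
  using mean_le[OF assms(1) bounded_pointwise_scale[OF assms(2), of "-1"], of "-b"]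
    mean_scale[OF assms(1,2), of "-1"] assms(3) by simp

lemma mean_on_point: "y \<in> Y \<Longrightarrow> mean_on Y (\<lambda>f. f y)"
  unfolding mean_on_def by auto

lemma mean_on_convex_combination:
  assumes m: "mean_on Y m" and n: "mean_on Y n" and "0 \<le> s" "0 \<le> t" "s + t = 1"
  shows "mean_on Y (\<lambda>f. s * m f + t * n f)"
  unfolding mean_on_def
proof (intro conjI allI impI)
  fix f and b :: real assume f: "bounded (f ` Y)" "\<forall>y\<in>Y. f y \<le> b"
  then have "m f \<le> b" "n f \<le> b"
    using mean_le[OF m] mean_le[OF n] by auto
  then have "s * m f + t * n f \<le> s * b + t * b"
    using assms by (intro add_mono mult_left_mono)
  then show "s * m f + t * n f \<le> b"
    using assms by (simp flip: distrib_right)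
qed (auto simp: mean_add[OF m] mean_add[OF n] mean_scale[OF m] mean_scale[OF n] algebra_simps)

text \<open>With its values on unbounded functions set to zero, a mean lies in a product of bounded
  sets of reals, where the Tychonoff theorem applies.\<close>

lemma mean_on_zero_if_unbounded:
  fixes m :: "('y \<Rightarrow> real) \<Rightarrow> real"
  assumes "mean_on Y m"
  shows "mean_on Y (\<lambda>f. if bounded (f ` Y) then m f else 0)"
  using mean_onD[OF assms] unfolding mean_on_def
  by (simp add: bounded_pointwise_add bounded_pointwise_scale)

lemma closed_mean_on: "closed {m. mean_on Y m}"
proof -
  have 1: "closed {m :: ('y \<Rightarrow> real) \<Rightarrow> real. P \<longrightarrow> m f \<le> b}" for P f b
    by (cases P) (auto intro!: closed_Collect_le continuous_on_product_coordinates)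
  have 2: "closed {m :: ('y \<Rightarrow> real) \<Rightarrow> real. P \<longrightarrow> m f = c * m g}" for P f g c
    by (cases P) (auto intro!: closed_Collect_eq continuous_intros continuous_on_product_coordinates)
  have 3: "closed {m :: ('y \<Rightarrow> real) \<Rightarrow> real. P \<longrightarrow> Q \<longrightarrow> m f = m g + m h}" for P Q f g h
    by (cases P; cases Q) (auto intro!: closed_Collect_eq continuous_intros continuous_on_product_coordinates)
  have 4: "closed {m :: ('y \<Rightarrow> real) \<Rightarrow> real. P \<longrightarrow> Q \<longrightarrow> m f \<le> b}" for P Q f b
    by (cases P; cases Q) (auto intro!: closed_Collect_le continuous_on_product_coordinates)
  show ?thesis
    unfolding mean_on_def by (intro closed_Collect_conj closed_Collect_all 2 3 4)
qed

text \<open>The means are closed under pointwise convergence and, once normalised on unbounded functions,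
  lie in a compact product; each condition \<open>\<bar>m (e i) - t i\<bar> \<le> \<epsilon>\<close> is closed, so the finite intersection
  property yields a mean that satisfies all of them.\<close>

lemma mean_with_prescribed_values:
  fixes e :: "'i \<Rightarrow> 'y \<Rightarrow> real" and t :: "'i \<Rightarrow> real"
  assumes approx: "\<And>D \<epsilon>. finite D \<Longrightarrow> 0 < \<epsilon> \<Longrightarrow>
      \<exists>m. mean_on Y m \<and> (\<forall>i\<in>D. \<bar>m (e i) - t i\<bar> \<le> \<epsilon>)"
    and bdd: "\<And>i. bounded (e i ` Y)"
  obtains m where "mean_on Y m" "\<And>i. m (e i) = t i"
proof -
  define S where "S = (\<lambda>f. if bounded (f ` Y)
      then {m f |m. mean_on Y m} else {0::real})"
  define K where "K = Pi\<^sub>E UNIV (\<lambda>f. closure (S f))"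
  define C where "C = (\<lambda>(i, \<epsilon>). {m. mean_on Y m \<and> \<bar>m (e i) - t i\<bar> \<le> \<epsilon>})"
  have "bounded (S f)" for f
  proof (cases "bounded (f ` Y)")
    case True
    then obtain b where b: "\<And>y. y \<in> Y \<Longrightarrow> \<bar>f y\<bar> \<le> b"
      unfolding bounded_iff by auto
    have "\<bar>m f\<bar> \<le> b" if "mean_on Y m" for m
      using mean_le[OF that True, of b] mean_ge[OF that True, of "-b"] b by (simp add: abs_le_iff) (smt (verit))
    then show ?thesis
      unfolding bounded_iff S_def using True by auto
  qed (simp add: S_def)
  then have "compact K"
    using compactin_PiE[of "\<lambda>_. euclidean" UNIV "\<lambda>f. closure (S f)"]
    by (simp add: K_def euclidean_product_topology)
  moreover have "closed (C i)" for i
  proof -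
    have "closed {m :: ('y \<Rightarrow> real) \<Rightarrow> real. \<bar>m (e i) - t i\<bar> \<le> \<epsilon>}" for i \<epsilon>
      by (intro closed_Collect_le continuous_intros continuous_on_product_coordinates)
    then show ?thesis
      unfolding C_def by (cases i) (auto intro!: closed_Collect_conj closed_mean_on)
  qed
  moreover have "K \<inter> (\<Inter>i\<in>I. C i) \<noteq> {}" if I: "finite I" "I \<subseteq> UNIV \<times> {0<..}" for I
  proof -
    define \<epsilon> where "\<epsilon> = Min (insert 1 (snd ` I))"
    have "\<epsilon> > 0"
      using I by (auto simp: \<epsilon>_def)
    then obtain m where m: "mean_on Y m" "\<And>i. i \<in> fst ` I \<Longrightarrow> \<bar>m (e i) - t i\<bar> \<le> \<epsilon>"
      using approx[of "fst ` I" \<epsilon>] I by fastforce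
    define n where "n = (\<lambda>f. if bounded (f ` Y) then m f else 0)"
    have "mean_on Y n"
      unfolding n_def by (rule mean_on_zero_if_unbounded[OF m(1)])
    moreover have "\<epsilon> \<le> k" if "(i, k) \<in> I" for i k
      unfolding \<epsilon>_def using I that by (force intro!: Min_le)
    moreover have "n (e i) = m (e i)" for i
      using bdd unfolding n_def by auto
    moreover have "\<bar>m (e i) - t i\<bar> \<le> \<epsilon>" if "(i, k) \<in> I" for i k
      using m(2) that by force
    ultimately have "n \<in> C (i, k)" if "(i, k) \<in> I" for i k
      using that unfolding C_def by (simp add: order_trans[of _ \<epsilon> k])
    then have "n \<in> C i" if "i \<in> I" for i
      using that by (cases i) simp
    moreover have "n \<in> K"
      unfolding K_def by (auto simp: n_def S_def intro!: closure_subset[THEN subsetD] m)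
    ultimately show ?thesis
      by blast
  qed
  ultimately have "K \<inter> (\<Inter>i\<in>UNIV \<times> {0<..}. C i) \<noteq> {}"
    by (rule compact_imp_fip_image)
  then obtain m where m: "\<And>i \<epsilon>. 0 < \<epsilon> \<Longrightarrow> m \<in> C (i, \<epsilon>)"
    by blast
  show thesis
  proof
    show "mean_on Y m"
      using m[of 1] unfolding C_def by simp
    fix i
    have "\<bar>m (e i) - t i\<bar> \<le> 0"
      by (rule field_le_epsilon) (use m in \<open>simp add: C_def\<close>)
    then show "m (e i) = t i"
      by simp
  qed
qed

section \<open>Cauchy filters in directed families of convex sets\<close>

text \<open>The members of the family shrink, so the minimal square mean over a member increases towards a
  supremum \<open>D\<close>.  If two functions of a late member have square mean at most \<open>D + k\<close>, then their midpoint
  has square mean above \<open>D - k\<close>, and the parallelogram law bounds the square mean of the difference by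
  \<open>8 k\<close>.  The limit itself would be an element of a completion, and a filter avoids it.\<close>

lemma Cauchy_filter_of_convex_family:
  fixes \<A> :: "('y \<Rightarrow> real) set set"
  assumes m: "mean_on Y m"
    and ne: "\<A> \<noteq> {}" "\<And>A. A \<in> \<A> \<Longrightarrow> A \<noteq> {}"
    and directed: "\<And>A B. A \<in> \<A> \<Longrightarrow> B \<in> \<A> \<Longrightarrow> \<exists>C\<in>\<A>. C \<subseteq> A \<inter> B"
    and midpoint: "\<And>A f g. A \<in> \<A> \<Longrightarrow> f \<in> A \<Longrightarrow> g \<in> A \<Longrightarrow> (\<lambda>y. (f y + g y) / 2) \<in> A"
    and bdd: "\<And>A f y. A \<in> \<A> \<Longrightarrow> f \<in> A \<Longrightarrow> y \<in> Y \<Longrightarrow> \<bar>f y\<bar> \<le> B"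
  obtains G where "G \<noteq> bot" "\<And>A. A \<in> \<A> \<Longrightarrow> eventually (\<lambda>f. f \<in> A) G"
    "\<And>\<eta>. 0 < \<eta> \<Longrightarrow> \<exists>P. eventually P G \<and> (\<forall>f g. P f \<longrightarrow> P g \<longrightarrow> m (\<lambda>y. (f y - g y)\<^sup>2) \<le> \<eta>)"
proof -
  define N where "N = (\<lambda>f. m (\<lambda>y. (f y)\<^sup>2))"
  define d where "d = (\<lambda>A. Inf (N ` A))"
  define D where "D = Sup (d ` \<A>)"
  define C where "C = (\<lambda>(A, k). {f \<in> A. N f \<le> D + k})"
  define I where "I = \<A> \<times> {0::real<..}"
  define G where "G = (INF i\<in>I. principal (C i))"
  have fb: "bounded (f ` Y)" if "A \<in> \<A>" "f \<in> A" for A f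
    using bdd[OF that] by (rule bounded_realI)
  have N_range: "0 \<le> N f" "N f \<le> B\<^sup>2" if "A \<in> \<A>" "f \<in> A" for A f
  proof -
    have "(f y)\<^sup>2 \<le> B\<^sup>2" if "y \<in> Y" for y
      using bdd[OF \<open>A \<in> \<A>\<close> \<open>f \<in> A\<close> that] by (metis abs_ge_self abs_le_square_iff order_trans)
    then show "0 \<le> N f" "N f \<le> B\<^sup>2"
      unfolding N_def
      by (auto intro!: mean_le[OF m] mean_ge[OF m] bounded_pointwise_square fb[OF that])
  qed
  have bb: "bdd_below (N ` A)" if "A \<in> \<A>" for A
    using N_range(1)[OF that] by (intro bdd_belowI[of _ 0]) auto
  have d_le: "d A \<le> N f" if "A \<in> \<A>" "f \<in> A" for A f
    unfolding d_def using bb that by (auto intro: cInf_lower)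
  have "d A \<le> B\<^sup>2" if "A \<in> \<A>" for A
    using ne(2)[OF that] d_le[OF that] N_range[OF that] by (metis all_not_in_conv order_trans)
  then have bD: "bdd_above (d ` \<A>)"
    by (intro bdd_aboveI[of _ "B\<^sup>2"]) auto
  have C_ne: "C i \<noteq> {}" if iI: "i \<in> I" for i
  proof -
    obtain A k where i: "i = (A, k)" "A \<in> \<A>" "0 < k"
      using iI unfolding I_def by auto
    have "d A < D + k"
      using cSup_upper[OF imageI[OF i(2), of d] bD] i(3) unfolding D_def by simp
    then obtain f where "f \<in> A" "N f < D + k"
      unfolding d_def using cInf_less_iff[OF _ bb[OF i(2)]] ne(2)[OF i(2)] by auto
    then show ?thesis
      unfolding C_def i by force
  qed
  have I_ne: "I \<noteq> {}"
    using ne(1) unfolding I_def by (auto intro: exI[of _ 1])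
  have I_dir: "\<exists>x\<in>I. principal (C x) \<le> inf (principal (C i)) (principal (C j))" if ijI: "i \<in> I" "j \<in> I" for i j
  proof -
    obtain A k A' k' where *: "i = (A, k)" "j = (A', k')" "A \<in> \<A>" "A' \<in> \<A>" "0 < k" "0 < k'"
      using ijI unfolding I_def by auto
    then obtain A'' where "A'' \<in> \<A>" "A'' \<subseteq> A \<inter> A'"
      using directed by blast
    then have "(A'', min k k') \<in> I" "C (A'', min k k') \<subseteq> C i \<inter> C j"
      using * unfolding C_def I_def by auto
    then show ?thesis
      by (intro bexI[of _ "(A'', min k k')"]) auto
  qed
  have ev: "eventually P G \<longleftrightarrow> (\<exists>i\<in>I. \<forall>f\<in>C i. P f)" for P
    unfolding G_def by (simp add: eventually_INF_base[OF I_ne I_dir] eventually_principal)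
  show thesis
  proof
    show "G \<noteq> bot"
      using C_ne by (force simp: trivial_limit_def ev)
    show "eventually (\<lambda>f. f \<in> A) G" if "A \<in> \<A>" for A
      unfolding ev using that by (intro bexI[of _ "(A, 1)"]) (auto simp: C_def I_def)
    fix \<eta> :: real
    assume \<eta>: "0 < \<eta>"
    \<comment> \<open>Four times the defect \<open>k\<close> for the two functions and four times for their midpoint.\<close>
    define k where "k = \<eta> / 8"
    have "D - k < D"
      using \<eta> by (simp add: k_def)
    then obtain A where A: "A \<in> \<A>" "D - k < d A"
      unfolding D_def using less_cSup_iff[OF _ bD] ne(1) by auto
    have "(A, k) \<in> I"
      using A \<eta> by (simp add: I_def k_def)
    moreover have "m (\<lambda>y. (f y - g y)\<^sup>2) \<le> \<eta>" if "f \<in> C (A, k)" "g \<in> C (A, k)" for f g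
    proof -
      let ?h = "\<lambda>y. (f y + g y) / 2"
      have fg: "f \<in> A" "g \<in> A" "N f \<le> D + k" "N g \<le> D + k"
        using that unfolding C_def by auto
      note b = fb[OF A(1) fg(1)] fb[OF A(1) fg(2)] fb[OF A(1) midpoint[OF A(1) fg(1,2)]]
      have "D - k < N ?h"
        using A(2) d_le[OF A(1) midpoint[OF A(1) fg(1,2)]] by linarith
      moreover have "(\<lambda>y. (f y - g y)\<^sup>2) = (\<lambda>y. (2 * (f y)\<^sup>2 + 2 * (g y)\<^sup>2) - 4 * (?h y)\<^sup>2)"
        by (simp add: fun_eq_iff power2_eq_square field_simps)
      then have "m (\<lambda>y. (f y - g y)\<^sup>2) = 2 * N f + 2 * N g - 4 * N ?h"
        unfolding N_def
        by (simp add: mean_diff[OF m] mean_add[OF m] mean_scale[OF m] bounded_pointwise_square[OF b(1)]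
            bounded_pointwise_square[OF b(2)] bounded_pointwise_square[OF b(3)] bounded_pointwise_add
            bounded_pointwise_scale del: power_divide)
      ultimately show ?thesis
        using fg \<eta> unfolding k_def by linarith
    qed
    ultimately show "\<exists>P. eventually P G \<and> (\<forall>f g. P f \<longrightarrow> P g \<longrightarrow> m (\<lambda>y. (f y - g y)\<^sup>2) \<le> \<eta>)"
      by (intro exI[of _ "\<lambda>f. f \<in> C (A, k)"]) (auto simp: ev)
  qed
qed

section \<open>Splitting by functions that are small at points and large in the mean\<close>

text \<open>The mean of the excess over \<open>a\<close> is used in place of the mean measure of \<open>{y \<in> W. f y > a}\<close>,
  because it depends continuously on \<open>f\<close>.\<close>

definition excess :: "real \<Rightarrow> 'y set \<Rightarrow> ('y \<Rightarrow> real) \<Rightarrow> 'y \<Rightarrow> real" where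
  "excess a W f = (\<lambda>y. if y \<in> W then max (f y - a) 0 else 0)"

text \<open>The functions along the filter \<open>G\<close> tend to zero at every point and yet keep their mean above
  \<open>c\<close>.  Dominated convergence excludes this for sequences and countably additive measures; for nets
  it can happen, and the Cauchy condition for the \<open>L\<^sup>2\<close>-seminorm then forces an independent sequence.\<close>

locale oscillating_filter =
  fixes T :: "'y topology" and Y :: "'y set" and m :: "('y \<Rightarrow> real) \<Rightarrow> real"
    and A :: "('y \<Rightarrow> real) set" and G :: "('y \<Rightarrow> real) filter" and B c :: real
  assumes mean: "mean_on Y m"
    and compact: "compactin T Y"
    and continuous: "\<And>f. f \<in> A \<Longrightarrow> continuous_map T euclidean f"
    and bound: "\<And>f y. f \<in> A \<Longrightarrow> y \<in> Y \<Longrightarrow> \<bar>f y\<bar> \<le> B"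
    and c_pos: "0 < c"
    and mean_large: "\<And>f. f \<in> A \<Longrightarrow> c \<le> m f"
    and nontrivial: "G \<noteq> bot"
    and eventually_A: "eventually (\<lambda>f. f \<in> A) G"
    and pointwise_small: "\<And>y k. y \<in> Y \<Longrightarrow> 0 < k \<Longrightarrow> eventually (\<lambda>f. \<bar>f y\<bar> \<le> k) G"
    and Cauchy: "\<And>\<eta>. 0 < \<eta> \<Longrightarrow>
      \<exists>P. eventually P G \<and> (\<forall>f g. P f \<longrightarrow> P g \<longrightarrow> m (\<lambda>y. (f y - g y)\<^sup>2) \<le> \<eta>)"
begin

text \<open>If the filter had an \<open>L\<^sup>2\<close>-limit \<open>g\<close>, the null sets would be those on which \<open>g \<le> c / 2\<close> almost
  everywhere.\<close>

definition null :: "'y set \<Rightarrow> bool" where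
  "null W \<longleftrightarrow> ((\<lambda>f. m (excess (c / 2) W f)) \<longlongrightarrow> 0) G"

lemma bounded_A: "f \<in> A \<Longrightarrow> bounded (f ` Y)"
  using bound by (blast intro: bounded_realI)

lemma bounded_excess:
  assumes "f \<in> A" shows "bounded (excess a W f ` Y)"
proof (rule bounded_realI)
  fix y assume "y \<in> Y"
  then show "\<bar>excess a W f y\<bar> \<le> B + \<bar>a\<bar>"
    using bound[OF assms, of y] unfolding excess_def by (auto simp: abs_if split: if_splits)
qed

lemma mean_excess_nonneg: "f \<in> A \<Longrightarrow> 0 \<le> m (excess a W f)"
  by (rule mean_ge[OF mean bounded_excess]) (auto simp: excess_def)

lemma null_subset:
  assumes "null W" "W' \<subseteq> W"
  shows "null W'"
  unfolding null_def
proof (rule tendsto_sandwich[OF _ _ tendsto_const assms(1)[unfolded null_def]])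
  show "\<forall>\<^sub>F f in G. 0 \<le> m (excess (c / 2) W' f)"
    using eventually_A by eventually_elim (rule mean_excess_nonneg)
  show "\<forall>\<^sub>F f in G. m (excess (c / 2) W' f) \<le> m (excess (c / 2) W f)"
    using eventually_A
  proof eventually_elim
    case (elim f)
    show ?case
      by (rule mean_mono[OF mean bounded_excess[OF elim] bounded_excess[OF elim]])
        (use assms(2) in \<open>auto simp: excess_def\<close>)
  qed
qed

lemma null_empty: "null {}"
proof -
  have "m (\<lambda>y. 0) = 0"
    using mean_scale[OF mean, of "\<lambda>_. 0" 0] by (simp add: image_constant_conv)
  then show ?thesis
    by (simp add: null_def excess_def)
qed

lemma null_Un:
  assumes "null W" "null W'"
  shows "null (W \<union> W')"
  unfolding null_def
proof (rule tendsto_sandwich[OF _ _ tendsto_const])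
  show "((\<lambda>f. m (excess (c / 2) W f) + m (excess (c / 2) W' f)) \<longlongrightarrow> 0) G"
    using tendsto_add[OF assms[unfolded null_def]] by simp
  show "\<forall>\<^sub>F f in G. 0 \<le> m (excess (c / 2) (W \<union> W') f)"
    using eventually_A by eventually_elim (rule mean_excess_nonneg)
  show "\<forall>\<^sub>F f in G. m (excess (c / 2) (W \<union> W') f) \<le> m (excess (c / 2) W f) + m (excess (c / 2) W' f)"
    using eventually_A
  proof eventually_elim
    case (elim f)
    note b = bounded_excess[OF elim]
    have "m (excess (c / 2) (W \<union> W') f) \<le> m (\<lambda>y. excess (c / 2) W f y + excess (c / 2) W' f y)"
      by (rule mean_mono[OF mean b bounded_pointwise_add[OF b b]]) (auto simp: excess_def max_def)
    then show ?case
      by (simp add: mean_add[OF mean b b])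
  qed
qed

lemma null_Union: "finite \<U> \<Longrightarrow> (\<And>U. U \<in> \<U> \<Longrightarrow> null U) \<Longrightarrow> null (\<Union>\<U>)"
  by (induction \<U> rule: finite_induct) (auto intro: null_Un null_empty)

lemma not_null_whole: "\<not> null Y"
proof
  assume "null Y"
  then have "\<forall>\<^sub>F f in G. m (excess (c / 2) Y f) < c / 2"
    unfolding null_def using c_pos by (intro order_tendstoD) auto
  moreover have "\<forall>\<^sub>F f in G. c / 2 \<le> m (excess (c / 2) Y f)"
    using eventually_A
  proof eventually_elim
    case (elim f)
    have const: "bounded ((\<lambda>_. c / 2) ` Y)"
      by (simp add: image_constant_conv)
    have "m (\<lambda>y. f y - c / 2) \<le> m (excess (c / 2) Y f)"
      by (rule mean_mono[OF mean bounded_pointwise_diff[OF bounded_A[OF elim] const] bounded_excess[OF elim]])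
        (auto simp: excess_def)
    moreover have "m (\<lambda>_. c / 2) \<le> c / 2"
      by (rule mean_le[OF mean const]) simp
    ultimately show ?case
      using mean_diff[OF mean bounded_A[OF elim] const] mean_large[OF elim] by linarith
  qed
  ultimately have "\<forall>\<^sub>F f in G. False"
    by eventually_elim simp
  then show False
    using nontrivial by simp
qed

text \<open>Otherwise finitely many open sets with null traces would cover \<open>W\<close>.  This replaces the support
  of a measure; it is for this covering argument that all sets in the construction are kept compact.\<close>

lemma not_null_concentrates:
  assumes "compactin T W" "\<not> null W"
  obtains y where "y \<in> W" "\<And>U. openin T U \<Longrightarrow> y \<in> U \<Longrightarrow> \<not> null (W \<inter> U)"
proof (rule ccontr)
  assume "\<not> thesis"
  then have "\<forall>y\<in>W. \<exists>U. openin T U \<and> y \<in> U \<and> null (W \<inter> U)"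
    using that by blast
  then obtain U where U: "\<And>y. y \<in> W \<Longrightarrow> openin T (U y) \<and> y \<in> U y \<and> null (W \<inter> U y)"
    by metis
  then obtain \<F> where \<F>: "finite \<F>" "\<F> \<subseteq> U ` W" "W \<subseteq> \<Union>\<F>"
    using assms(1) unfolding compactin_def by (smt (verit) UN_I image_iff subsetI)
  have "null (\<Union>((\<lambda>V. W \<inter> V) ` \<F>))"
    by (rule null_Union) (use \<F> U in auto)
  then have "null W"
    by (rule null_subset) (use \<F>(3) in auto)
  then show False
    using assms(2) by simp
qed

text \<open>A late \<open>f\<close> is close in the mean to all later functions, and these exceed \<open>c / 2\<close> on a
  non-negligible part of \<open>W\<close>; so \<open>f\<close> exceeds the smaller threshold \<open>c / 3\<close> on most of that part.\<close>

lemma not_null_ge: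
  assumes f: "f \<in> A" "\<forall>\<^sub>F g in G. m (\<lambda>y. (g y - f y)\<^sup>2) \<le> \<eta> * c / 12"
    and large: "\<exists>\<^sub>F g in G. \<eta> < m (excess (c / 2) W g)" and "0 < \<eta>"
  shows "\<not> null (W \<inter> {y. c / 3 \<le> f y})"
proof
  let ?W = "W \<inter> {y. c / 3 \<le> f y}"
  assume "null ?W"
  then have "\<forall>\<^sub>F g in G. m (excess (c / 2) ?W g) < \<eta> / 2"
    unfolding null_def using \<open>0 < \<eta>\<close> by (intro order_tendstoD) auto
  then have "\<forall>\<^sub>F g in G. m (excess (c / 2) W g) \<le> \<eta>"
    using f(2) eventually_A
  proof eventually_elim
    case (elim g)
    note b = bounded_excess[OF elim(3)]
    have sq: "bounded ((\<lambda>y. (g y - f y)\<^sup>2) ` Y)"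
      by (intro bounded_pointwise_square bounded_pointwise_diff bounded_A elim f)
    \<comment> \<open>Where \<open>g > c / 2\<close> and \<open>f < c / 3\<close> the gap \<open>c / 6\<close> bounds \<open>g - f\<close> by its square.\<close>
    have "excess (c / 2) W g y \<le> excess (c / 2) ?W g y + 6 / c * (g y - f y)\<^sup>2" for y
    proof (cases "y \<in> W \<and> f y < c / 3 \<and> c / 2 < g y")
      case True
      then have gap: "c / 6 \<le> g y - f y"
        by simp
      have "g y - c / 2 \<le> g y - f y"
        using True c_pos by (simp add: field_simps)
      also have "\<dots> \<le> 6 / c * ((g y - f y) * (g y - f y))"
        using mult_right_mono[OF gap, of "g y - f y"] gap c_pos by (simp add: field_simps)
      finally show ?thesis
        using True by (simp add: excess_def power2_eq_square)
    next
      case False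
      then have "excess (c / 2) W g y \<le> excess (c / 2) ?W g y"
        by (auto simp: excess_def)
      then show ?thesis
        using c_pos by (simp add: add_increasing2)
    qed
    then have "m (excess (c / 2) W g) \<le> m (\<lambda>y. excess (c / 2) ?W g y + 6 / c * (g y - f y)\<^sup>2)"
      by (intro mean_mono[OF mean b bounded_pointwise_add[OF b bounded_pointwise_scale[OF sq]]])
    also have "\<dots> = m (excess (c / 2) ?W g) + 6 / c * m (\<lambda>y. (g y - f y)\<^sup>2)"
      by (simp only: mean_add[OF mean b bounded_pointwise_scale[OF sq]] mean_scale[OF mean sq])
    also have "6 / c * m (\<lambda>y. (g y - f y)\<^sup>2) \<le> 6 / c * (\<eta> * c / 12)"
      using elim(2) c_pos by (intro mult_left_mono) auto
    also have "\<dots> = \<eta> / 2"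
      using c_pos by simp
    finally show ?case
      using elim(1) by linarith
  qed
  then show False
    using large by (simp add: frequently_def not_less)
qed

text \<open>Choose in each \<open>W\<close> a point at which non-negligibility concentrates.  A late function is small at
  these finitely many points, hence on neighbourhoods of them, which gives the lower parts; the upper
  parts come from the Cauchy condition.\<close>

lemma simultaneous_splitting:
  assumes \<W>: "finite \<W>" "\<And>W. W \<in> \<W> \<Longrightarrow> compactin T W \<and> W \<subseteq> Y \<and> \<not> null W"
  obtains f where "f \<in> A"
    "\<And>W. W \<in> \<W> \<Longrightarrow> \<not> null (W \<inter> {y. c / 3 \<le> f y}) \<and> \<not> null (W \<inter> {y. f y \<le> c / 4})"
proof -
  have "\<exists>y\<in>W. \<forall>U. openin T U \<longrightarrow> y \<in> U \<longrightarrow> \<not> null (W \<inter> U)" if "W \<in> \<W>" for W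
    using not_null_concentrates[of W] \<W>(2)[OF that] by metis
  then obtain p where p: "\<And>W. W \<in> \<W> \<Longrightarrow> p W \<in> W"
    "\<And>W U. W \<in> \<W> \<Longrightarrow> openin T U \<Longrightarrow> p W \<in> U \<Longrightarrow> \<not> null (W \<inter> U)"
    by metis
  have "\<exists>\<eta>>0. \<exists>\<^sub>F g in G. \<eta> < m (excess (c / 2) W g)" if W: "W \<in> \<W>" for W
  proof (rule ccontr)
    assume *: "\<not> (\<exists>\<eta>>0. \<exists>\<^sub>F g in G. \<eta> < m (excess (c / 2) W g))"
    have "null W"
      unfolding null_def
    proof (rule order_tendstoI)
      fix a :: real assume "a < 0"
      with eventually_A show "\<forall>\<^sub>F f in G. a < m (excess (c / 2) W f)"
        by (auto elim!: eventually_mono intro: less_le_trans mean_excess_nonneg)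
    next
      fix a :: real assume "0 < a"
      then have "0 < a / 2"
        by simp
      with * have "\<forall>\<^sub>F g in G. m (excess (c / 2) W g) \<le> a / 2"
        unfolding frequently_def not_less by blast
      then show "\<forall>\<^sub>F f in G. m (excess (c / 2) W f) < a"
        by eventually_elim (use \<open>0 < a\<close> in simp)
    qed
    then show False
      using \<W>(2)[OF W] by simp
  qed
  then obtain \<eta> where \<eta>: "\<And>W. W \<in> \<W> \<Longrightarrow> 0 < \<eta> W"
    "\<And>W. W \<in> \<W> \<Longrightarrow> \<exists>\<^sub>F g in G. \<eta> W < m (excess (c / 2) W g)"
    by metis
  have "\<exists>P. eventually P G \<and> (\<forall>f g. P f \<longrightarrow> P g \<longrightarrow> m (\<lambda>y. (f y - g y)\<^sup>2) \<le> \<eta> W * c / 12)"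
    if "W \<in> \<W>" for W
    using \<eta>(1)[OF that] c_pos by (intro Cauchy) simp
  then obtain P where P: "\<And>W. W \<in> \<W> \<Longrightarrow> eventually (P W) G"
    "\<And>W f g. W \<in> \<W> \<Longrightarrow> P W f \<Longrightarrow> P W g \<Longrightarrow> m (\<lambda>y. (f y - g y)\<^sup>2) \<le> \<eta> W * c / 12"
    by metis
  have "\<forall>\<^sub>F f in G. \<bar>f (p W)\<bar> \<le> c / 8" if "W \<in> \<W>" for W
    using that p(1) \<W>(2) c_pos by (intro pointwise_small) auto
  then have "\<forall>\<^sub>F f in G. \<forall>W\<in>\<W>. P W f \<and> \<bar>f (p W)\<bar> \<le> c / 8"
    using P(1) by (intro eventually_ball_finite \<W>(1)) (auto intro: eventually_conj)
  with eventually_A have "\<forall>\<^sub>F f in G. f \<in> A \<and> (\<forall>W\<in>\<W>. P W f \<and> \<bar>f (p W)\<bar> \<le> c / 8)"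
    by eventually_elim simp
  then have "\<exists>f. f \<in> A \<and> (\<forall>W\<in>\<W>. P W f \<and> \<bar>f (p W)\<bar> \<le> c / 8)"
    by (rule eventually_happens'[OF nontrivial])
  then obtain f where f: "f \<in> A" "\<And>W. W \<in> \<W> \<Longrightarrow> P W f \<and> \<bar>f (p W)\<bar> \<le> c / 8"
    by blast
  show thesis
  proof (rule that[OF f(1)], intro conjI)
    fix W assume W: "W \<in> \<W>"
    have "\<forall>\<^sub>F g in G. m (\<lambda>y. (g y - f y)\<^sup>2) \<le> \<eta> W * c / 12"
      using P(1)[OF W] by eventually_elim (use P(2)[OF W] f(2)[OF W] in blast)
    then show "\<not> null (W \<inter> {y. c / 3 \<le> f y})"
      using not_null_ge[OF f(1) _ \<eta>(2)[OF W] \<eta>(1)[OF W]] by blast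
    have "openin T {y \<in> topspace T. f y < c / 4}"
      using openin_continuous_map_preimage[OF continuous[OF f(1)], of "{..<c / 4}"] by simp
    moreover have "p W \<in> topspace T"
      using p(1)[OF W] \<W>(2)[OF W] compactin_subset_topspace by blast
    moreover have "f (p W) < c / 4"
      using f(2)[OF W] c_pos by linarith
    ultimately have "\<not> null (W \<inter> {y \<in> topspace T. f y < c / 4})"
      by (intro p(2)[OF W]) auto
    moreover have "W \<inter> {y \<in> topspace T. f y < c / 4} \<subseteq> W \<inter> {y. f y \<le> c / 4}"
      by auto
    ultimately show "\<not> null (W \<inter> {y. f y \<le> c / 4})"
      using null_subset by blast
  qed
qed

text \<open>Splitting repeatedly refines \<open>Y\<close> into a binary tree of non-null, hence nonempty, compact cells.\<close>

lemma independent_sequence: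
  obtains f :: "nat \<Rightarrow> 'y \<Rightarrow> real" where "\<And>n. f n \<in> A"
    "\<And>\<sigma> N. \<exists>y\<in>Y. \<forall>n<N. if \<sigma> n then c / 3 \<le> f n y else f n y \<le> c / 4"
proof -
  define split where "split = (\<lambda>(f :: 'y \<Rightarrow> real) W. {W \<inter> {y. c / 3 \<le> f y}, W \<inter> {y. f y \<le> c / 4}})"
  define good where "good = (\<lambda>(\<W>, f). finite \<W> \<and>
      (\<forall>W\<in>\<W>. compactin T W \<and> W \<subseteq> Y \<and> \<not> null W) \<and> f \<in> A)"
  have "A \<noteq> {}"
    using eventually_happens'[OF nontrivial eventually_A] by auto
  then have "\<exists>s. good s"
    using compact not_null_whole by (auto simp: good_def intro!: exI[of _ "{Y}"])
  moreover have "\<exists>s'. good s' \<and> fst s' = (\<Union>W\<in>fst s. split (snd s') W)" if "good s" for s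
  proof -
    obtain \<W> g where s: "s = (\<W>, g)" "finite \<W>" "\<And>W. W \<in> \<W> \<Longrightarrow> compactin T W \<and> W \<subseteq> Y \<and> \<not> null W"
      using \<open>good s\<close> unfolding good_def by auto
    obtain f where f: "f \<in> A" "\<And>W. W \<in> \<W> \<Longrightarrow>
        \<not> null (W \<inter> {y. c / 3 \<le> f y}) \<and> \<not> null (W \<inter> {y. f y \<le> c / 4})"
      using simultaneous_splitting[OF s(2,3)] by blast
    have "closedin T {y \<in> topspace T. c / 3 \<le> f y}" "closedin T {y \<in> topspace T. f y \<le> c / 4}"
      using closedin_continuous_map_preimage[OF continuous[OF f(1)], of "{c / 3..}"]
        closedin_continuous_map_preimage[OF continuous[OF f(1)], of "{..c / 4}"] by auto
    moreover have "W \<inter> {y. c / 3 \<le> f y} = {y \<in> topspace T. c / 3 \<le> f y} \<inter> W"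
      "W \<inter> {y. f y \<le> c / 4} = {y \<in> topspace T. f y \<le> c / 4} \<inter> W" if "W \<in> \<W>" for W
      using s(3)[OF that] compactin_subset_topspace by blast+
    ultimately have "compactin T W'" if "W \<in> \<W>" "W' \<in> split f W" for W W'
      using that s(3) closed_Int_compactin unfolding split_def by fastforce
    then have "good (\<Union>W\<in>\<W>. split f W, f)"
      using s f unfolding good_def by (auto simp: split_def)
    then show ?thesis
      using s by (intro exI[of _ "(\<Union>W\<in>\<W>. split f W, f)"]) auto
  qed
  moreover define s0 where "s0 = ({Y}, SOME f. f \<in> A)"
  moreover have "good s0"
    using \<open>A \<noteq> {}\<close> compact not_null_whole by (auto simp: good_def s0_def some_in_eq)
  ultimately obtain s where s: "\<And>n. good (s n)" "s 0 = s0"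
    "\<And>n. fst (s (Suc n)) = (\<Union>W\<in>fst (s n). split (snd (s (Suc n))) W)"
    using dependent_nat_choice[of "\<lambda>n s. good s \<and> (n = 0 \<longrightarrow> s = s0)"
        "\<lambda>_ s s'. fst s' = (\<Union>W\<in>fst s. split (snd s') W)"]
    by (metis nat.distinct(1))
  define f where "f = (\<lambda>n. snd (s (Suc n)))"
  have cell: "{y \<in> Y. \<forall>n<N. if \<sigma> n then c / 3 \<le> f n y else f n y \<le> c / 4} \<in> fst (s N)" for \<sigma> N
  proof (induction N)
    case 0
    then show ?case
      by (simp add: s(2) s0_def)
  next
    case (Suc N)
    let ?C = "\<lambda>N. {y \<in> Y. \<forall>n<N. if \<sigma> n then c / 3 \<le> f n y else f n y \<le> c / 4}"
    have "?C (Suc N) \<in> split (f N) (?C N)"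
      by (cases "\<sigma> N") (auto simp: split_def less_Suc_eq)
    moreover have "fst (s (Suc N)) = (\<Union>W\<in>fst (s N). split (f N) W)"
      using s(3) by (simp add: f_def)
    ultimately show ?case
      using Suc by blast
  qed
  show thesis
  proof (rule that)
    show "f n \<in> A" for n
      using s(1)[of "Suc n"] by (auto simp: good_def f_def split: prod.splits)
    show "\<exists>y\<in>Y. \<forall>n<N. if \<sigma> n then c / 3 \<le> f n y else f n y \<le> c / 4" for \<sigma> N
    proof -
      have "\<not> null W" if "W \<in> fst (s N)" for W
        using that s(1)[of N] by (simp add: good_def case_prod_beta)
      from this[OF cell[where \<sigma> = \<sigma> and N = N]]
      have "{y \<in> Y. \<forall>n<N. if \<sigma> n then c / 3 \<le> f n y else f n y \<le> c / 4} \<noteq> {}"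
        using null_empty by (intro notI) (simp only: simp_thms)
      then show ?thesis
        by blast
    qed
  qed
qed

end

section \<open>Independent sequences and copies of \<open>l\<^sub>1\<close>\<close>

text \<open>Independence bounds the norm of a finite linear combination from below by a fixed multiple of the
  sum of the absolute values of its coefficients, and the estimate passes to infinite sums.\<close>

lemma l1_embedding_of_independent:
  fixes u :: "nat \<Rightarrow> 'v::banach" and Y :: "('v \<Rightarrow>\<^sub>L real) set"
  assumes u: "\<And>n. norm (u n) \<le> R" and Y: "\<And>y. y \<in> Y \<Longrightarrow> norm y \<le> r" and "0 < r" "b' < b"
    and indep: "\<And>\<sigma> N. \<exists>y\<in>Y. \<forall>n<N. if \<sigma> n then b \<le> y (u n) else y (u n) \<le> b'"
  shows "l1_embedding (\<lambda>a. \<Sum>n. a n *\<^sub>R u n)"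
proof -
  have summ: "summable (\<lambda>n. norm (a n *\<^sub>R u n))" if "a \<in> l1_seqs" for a
  proof (rule summable_comparison_test')
    show "summable (\<lambda>n. R * \<bar>a n\<bar>)"
      using that by (simp add: l1_seqs_def summable_mult)
    show "norm (norm (a n *\<^sub>R u n)) \<le> R * \<bar>a n\<bar>" if "0 \<le> n" for n
      using mult_left_mono[OF u[of n], of "\<bar>a n\<bar>"] by (simp add: mult.commute)
  qed
  have sv: "summable (\<lambda>n. a n *\<^sub>R u n)" if "a \<in> l1_seqs" for a
    using summable_norm_cancel[OF summ[OF that]] .
  have upper: "norm (\<Sum>n. a n *\<^sub>R u n) \<le> R * l1_norm a" if "a \<in> l1_seqs" for a
  proof -
    have "norm (\<Sum>n. a n *\<^sub>R u n) \<le> (\<Sum>n. norm (a n *\<^sub>R u n))"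
      by (rule summable_norm[OF summ[OF that]])
    also have "\<dots> \<le> (\<Sum>n. R * \<bar>a n\<bar>)"
    proof (rule suminf_le[OF _ summ[OF that]])
      show "norm (a n *\<^sub>R u n) \<le> R * \<bar>a n\<bar>" for n
        using mult_left_mono[OF u[of n], of "\<bar>a n\<bar>"] by (simp add: mult.commute)
      show "summable (\<lambda>n. R * \<bar>a n\<bar>)"
        using that by (simp add: l1_seqs_def summable_mult)
    qed
    also have "\<dots> = R * l1_norm a"
      using that by (simp add: l1_seqs_def l1_norm_def suminf_mult)
    finally show ?thesis .
  qed
  \<comment> \<open>One functional sees the positive coefficients above \<open>b\<close> and the negative ones below \<open>b'\<close>,
    another does the opposite; their difference exceeds \<open>b - b'\<close> times the \<open>l\<^sub>1\<close>-norm.\<close>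
  have lower_fin: "(b - b') * (\<Sum>n<N. \<bar>a n\<bar>) \<le> 2 * r * norm (\<Sum>n<N. a n *\<^sub>R u n)" for a N
  proof -
    let ?x = "\<Sum>n<N. a n *\<^sub>R u n"
    obtain y where y: "y \<in> Y" "\<forall>n<N. if 0 \<le> a n then b \<le> y (u n) else y (u n) \<le> b'"
      using indep[of N "\<lambda>n. 0 \<le> a n"] by blast
    obtain z where z: "z \<in> Y" "\<forall>n<N. if \<not> 0 \<le> a n then b \<le> z (u n) else z (u n) \<le> b'"
      using indep[of N "\<lambda>n. \<not> 0 \<le> a n"] by blast
    have "(b - b') * \<bar>a n\<bar> \<le> a n * (y (u n) - z (u n))" if "n < N" for n
    proof (cases "0 \<le> a n")
      case True
      then have "b - b' \<le> y (u n) - z (u n)"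
        using y(2) z(2) that by (smt (verit))
      then show ?thesis
        using True by (simp add: mult.commute mult_left_mono)
    next
      case False
      then have "b - b' \<le> z (u n) - y (u n)"
        using y(2) z(2) that by (smt (verit))
      from mult_left_mono[OF this, of "- a n"] show ?thesis
        using False by (simp add: algebra_simps)
    qed
    then have "(b - b') * (\<Sum>n<N. \<bar>a n\<bar>) \<le> (\<Sum>n<N. a n * (y (u n) - z (u n)))"
      unfolding sum_distrib_left by (intro sum_mono) auto
    also have "\<dots> = y ?x - z ?x"
      by (simp add: blinfun.sum_right blinfun.scaleR_right sum_subtractf algebra_simps)
    also have "\<dots> \<le> norm (y ?x) + norm (z ?x)"
      by simp
    also have "\<dots> \<le> r * norm ?x + r * norm ?x"
      using Y[OF y(1)] Y[OF z(1)]
      by (intro add_mono order_trans[OF norm_blinfun] mult_right_mono) auto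
    finally show ?thesis
      by simp
  qed
  have lower: "(b - b') / (2 * r) * l1_norm a \<le> norm (\<Sum>n. a n *\<^sub>R u n)" if "a \<in> l1_seqs" for a
  proof -
    have "(\<lambda>N. (b - b') * (\<Sum>n<N. \<bar>a n\<bar>)) \<longlonglongrightarrow> (b - b') * l1_norm a"
      using that unfolding l1_seqs_def l1_norm_def by (intro tendsto_mult_left summable_LIMSEQ) simp
    moreover have "(\<lambda>N. 2 * r * norm (\<Sum>n<N. a n *\<^sub>R u n)) \<longlonglongrightarrow> 2 * r * norm (\<Sum>n. a n *\<^sub>R u n)"
      by (intro tendsto_mult_left tendsto_norm summable_LIMSEQ sv[OF that])
    ultimately have "(b - b') * l1_norm a \<le> 2 * r * norm (\<Sum>n. a n *\<^sub>R u n)"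
      using lower_fin by (intro LIMSEQ_le) auto
    then show ?thesis
      using \<open>0 < r\<close> by (simp add: field_simps)
  qed
  show ?thesis
    unfolding l1_embedding_def
  proof (intro conjI ballI allI)
    show "(\<Sum>n. (a n + b n) *\<^sub>R u n) = (\<Sum>n. a n *\<^sub>R u n) + (\<Sum>n. b n *\<^sub>R u n)"
      if "a \<in> l1_seqs" "b \<in> l1_seqs" for a b
      using suminf_add[OF sv[OF that(1)] sv[OF that(2)]] by (simp add: scaleR_left_distrib)
    show "(\<Sum>n. (c * a n) *\<^sub>R u n) = c *\<^sub>R (\<Sum>n. a n *\<^sub>R u n)" if "a \<in> l1_seqs" for c a
      using suminf_scaleR_right[OF sv[OF that], of c] by simp
    show "\<exists>k>0. \<exists>M. \<forall>a\<in>l1_seqs. k * l1_norm a \<le> norm (\<Sum>n. a n *\<^sub>R u n) \<and>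
        norm (\<Sum>n. a n *\<^sub>R u n) \<le> M * l1_norm a"
      using lower upper \<open>0 < r\<close> \<open>b' < b\<close>
      by (intro exI[of _ "(b - b') / (2 * r)"] conjI exI[of _ R]) auto
  qed
qed

section \<open>The weak-star topology\<close>

lemma topspace_weak_star [simp]: "topspace weak_star_topology = UNIV"
  by (simp add: weak_star_topology_def topspace_pullback_topology)

lemma continuous_map_weak_star_eval:
  "continuous_map weak_star_topology euclidean (\<lambda>\<phi> :: 'v::real_normed_vector \<Rightarrow>\<^sub>L real. \<phi> v)"
proof -
  have "continuous_map euclidean euclidean (\<lambda>f :: 'v \<Rightarrow> real. f v)"
    by (simp add: continuous_on_product_coordinates)
  from continuous_map_pullback[OF this, of UNIV blinfun_apply] show ?thesis
    by (simp add: weak_star_topology_def comp_def)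
qed

lemma continuous_map_into_weak_star:
  assumes "\<And>v. continuous_map X euclidean (\<lambda>x. blinfun_apply (f x) v)"
  shows "continuous_map X weak_star_topology f"
proof -
  have "continuous_map X euclidean (blinfun_apply \<circ> f)"
    using assms by (simp add: continuous_map_componentwise_UNIV comp_def flip: euclidean_product_topology)
  then show ?thesis
    unfolding weak_star_topology_def by (rule continuous_map_pullback') simp
qed

lemma Hausdorff_weak_star:
  "Hausdorff_space (weak_star_topology :: ('v::real_normed_vector \<Rightarrow>\<^sub>L real) topology)"
  unfolding Hausdorff_space_def
proof (intro allI impI)
  fix \<phi> \<psi> :: "'v \<Rightarrow>\<^sub>L real"
  assume "\<phi> \<in> topspace weak_star_topology \<and> \<psi> \<in> topspace weak_star_topology \<and> \<phi> \<noteq> \<psi>"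
  then obtain v where "\<phi> v \<noteq> \<psi> v"
    by (meson blinfun_eqI)
  then obtain U U' where U: "open U" "open U'" "\<phi> v \<in> U" "\<psi> v \<in> U'" "U \<inter> U' = {}"
    using hausdorff[OF \<open>\<phi> v \<noteq> \<psi> v\<close>] by metis
  have *: "openin weak_star_topology {\<phi> :: 'v \<Rightarrow>\<^sub>L real. \<phi> v \<in> W}" if "open W" for W
    using openin_continuous_map_preimage[OF continuous_map_weak_star_eval[of v], of W] that by simp
  then show "\<exists>U V. openin weak_star_topology U \<and> openin weak_star_topology V \<and> \<phi> \<in> U \<and> \<psi> \<in> V \<and> disjnt U V"
    using *[OF U(1)] *[OF U(2)] U
    by (intro exI[of _ "{\<phi> :: 'v \<Rightarrow>\<^sub>L real. \<phi> v \<in> U}"] exI[of _ "{\<phi> :: 'v \<Rightarrow>\<^sub>L real. \<phi> v \<in> U'}"])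
      (auto simp: disjnt_def)
qed

text \<open>The Banach-Alaoglu theorem: the ball is the image of a closed subset of a compact product under
  the map that bundles a bounded linear function.\<close>

lemma compactin_weak_star_cball:
  "compactin weak_star_topology (cball (0 :: 'v::real_normed_vector \<Rightarrow>\<^sub>L real) r)"
proof (cases "0 \<le> r")
  case True
  define F where "F = {f :: 'v \<Rightarrow> real. (\<forall>x y. f (x + y) = f x + f y) \<and> (\<forall>c x. f (c *\<^sub>R x) = c * f x)}"
  define P where "P = Pi\<^sub>E UNIV (\<lambda>v :: 'v. {- (r * norm v)..r * norm v})"
  have "compact P"
    using compactin_PiE[of "\<lambda>_. euclidean" UNIV "\<lambda>v :: 'v. {- (r * norm v)..r * norm v}"]
    by (simp add: P_def euclidean_product_topology)
  moreover have "closed F"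
  proof -
    have "closed {f :: 'v \<Rightarrow> real. f (x + y) = f x + f y}" for x y
      by (intro closed_Collect_eq continuous_intros continuous_on_product_coordinates)
    moreover have "closed {f :: 'v \<Rightarrow> real. f (c *\<^sub>R x) = c * f x}" for c x
      by (intro closed_Collect_eq continuous_intros continuous_on_product_coordinates)
    ultimately show ?thesis
      unfolding F_def by (intro closed_Collect_conj closed_Collect_all)
  qed
  ultimately have PF: "compact (P \<inter> F)"
    by (rule compact_Int_closed)
  have blinfun_PF: "blinfun_apply (Blinfun f) = f" "norm (Blinfun f) \<le> r" if "f \<in> P \<inter> F" for f
  proof -
    have le: "\<bar>f v\<bar> \<le> r * norm v" for v
      using that by (simp add: P_def PiE_iff abs_le_iff minus_le_iff)
    have "bounded_linear f"
      by (rule bounded_linear_intro[of _ r]) (use that le in \<open>auto simp: F_def mult.commute\<close>)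
    then show *: "blinfun_apply (Blinfun f) = f"
      by (rule bounded_linear_Blinfun_apply)
    show "norm (Blinfun f) \<le> r"
      using le True by (intro norm_blinfun_bound) (auto simp: *)
  qed
  have PF_mem: "blinfun_apply \<phi> \<in> P \<inter> F" if "norm \<phi> \<le> r" for \<phi> :: "'v \<Rightarrow>\<^sub>L real"
  proof -
    have "\<bar>\<phi> v\<bar> \<le> r * norm v" for v
      using norm_blinfun[of \<phi> v] mult_right_mono[OF that norm_ge_zero[of v]] by simp
    then show ?thesis
      by (auto simp: P_def F_def PiE_iff abs_le_iff minus_le_iff blinfun.add_right blinfun.scaleR_right)
  qed
  have "continuous_map (top_of_set (P \<inter> F)) weak_star_topology Blinfun"
  proof (rule continuous_map_into_weak_star)
    fix v
    have "continuous_on (P \<inter> F) (\<lambda>f. f v)"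
      by (rule continuous_on_subset[OF continuous_on_product_coordinates]) simp
    then have "continuous_on (P \<inter> F) (\<lambda>f. blinfun_apply (Blinfun f) v)"
      by (rule continuous_on_eq) (simp add: blinfun_PF)
    then show "continuous_map (top_of_set (P \<inter> F)) euclidean (\<lambda>f. blinfun_apply (Blinfun f) v)"
      by simp
  qed
  moreover have "compactin (top_of_set (P \<inter> F)) (P \<inter> F)"
    using PF by (simp add: compactin_subtopology)
  ultimately have "compactin weak_star_topology (Blinfun ` (P \<inter> F))"
    by (rule image_compactin[rotated])
  moreover have "Blinfun ` (P \<inter> F) = cball 0 r"
    using blinfun_PF(2) PF_mem by (force simp: blinfun_apply_inverse image_iff)
  ultimately show ?thesis
    by simp
qed simp

lemma weak_star_closure_approx:
  fixes \<phi>\<^sub>0 :: "'v::real_normed_vector \<Rightarrow>\<^sub>L real"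
  assumes "\<phi>\<^sub>0 \<in> weak_star_topology closure_of S" "finite D" "0 < \<epsilon>"
  obtains \<phi> where "\<phi> \<in> S" "\<And>v. v \<in> D \<Longrightarrow> \<bar>\<phi> v - \<phi>\<^sub>0 v\<bar> \<le> \<epsilon>"
proof -
  let ?U = "\<Inter>v\<in>D. {\<phi> :: 'v \<Rightarrow>\<^sub>L real. \<phi> v \<in> ball (\<phi>\<^sub>0 v) \<epsilon>}"
  have "openin weak_star_topology {\<phi> :: 'v \<Rightarrow>\<^sub>L real. \<phi> v \<in> ball (\<phi>\<^sub>0 v) \<epsilon>}" for v
    using openin_continuous_map_preimage[OF continuous_map_weak_star_eval[of v], of "ball (\<phi>\<^sub>0 v) \<epsilon>"]
    by simp
  then have "openin weak_star_topology (UNIV \<inter> ?U)"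
    by (cases "D = {}") (auto intro!: openin_Inter assms(2) simp: openin_topspace[of weak_star_topology, simplified])
  moreover have "\<phi>\<^sub>0 \<in> ?U"
    using assms(3) by simp
  ultimately obtain \<phi> where "\<phi> \<in> S" "\<phi> \<in> ?U"
    using assms(1) unfolding in_closure_of by (metis (no_types, lifting) Int_iff UNIV_I)
  then show thesis
    by (intro that[of \<phi>]) (auto simp: dist_real_def intro: less_imp_le)
qed

lemma linear_dual_action: "linear (dual_action h s)"
  by (rule linearI; rule blinfun_eqI) (simp_all add: dual_action_def blinfun.add_left blinfun.scaleR_left)

lemma continuous_map_dual_action:
  "continuous_map weak_star_topology weak_star_topology (dual_action h s)"
  by (rule continuous_map_into_weak_star) (simp add: dual_action_def continuous_map_weak_star_eval)

lemma homeomorphic_maps_weak_star_scale: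
  assumes "0 < r"
  shows "homeomorphic_maps weak_star_topology weak_star_topology
    (\<lambda>\<phi> :: 'v::real_normed_vector \<Rightarrow>\<^sub>L real. \<phi> /\<^sub>R r) (\<lambda>\<phi>. r *\<^sub>R \<phi>)"
proof -
  have "continuous_map weak_star_topology weak_star_topology (\<lambda>\<phi> :: 'v \<Rightarrow>\<^sub>L real. a *\<^sub>R \<phi>)" for a
    by (rule continuous_map_into_weak_star)
      (simp add: blinfun.scaleR_left continuous_map_real_mult_left continuous_map_weak_star_eval)
  then show ?thesis
    using assms by (auto simp: homeomorphic_maps_def)
qed

section \<open>Functions in the bidual\<close>

text \<open>By Goldstine's theorem these are the restrictions to \<open>K\<close> of the elements of the bidual of norm
  at most \<open>R\<close>.\<close>

definition bidual_on :: "real \<Rightarrow> ('v::real_normed_vector \<Rightarrow>\<^sub>L real) set \<Rightarrow> (('v \<Rightarrow>\<^sub>L real) \<Rightarrow> real) \<Rightarrow> bool" where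
  "bidual_on R K f \<longleftrightarrow> (\<forall>F \<epsilon>. finite F \<longrightarrow> F \<subseteq> K \<longrightarrow> 0 < \<epsilon> \<longrightarrow>
     (\<exists>u. norm u \<le> R \<and> (\<forall>\<phi>\<in>F. \<bar>blinfun_apply \<phi> u - f \<phi>\<bar> \<le> \<epsilon>)))"

lemma bidual_onE:
  assumes "bidual_on R K f" "finite F" "F \<subseteq> K" "0 < \<epsilon>"
  obtains u where "norm u \<le> R" "\<And>\<phi>. \<phi> \<in> F \<Longrightarrow> \<bar>blinfun_apply \<phi> u - f \<phi>\<bar> \<le> \<epsilon>"
proof -
  have "\<exists>u. norm u \<le> R \<and> (\<forall>\<phi>\<in>F. \<bar>blinfun_apply \<phi> u - f \<phi>\<bar> \<le> \<epsilon>)"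
    using assms by (simp add: bidual_on_def)
  then show thesis
    by (elim exE) (rule that, auto)
qed

lemma bidual_on_subset:
  assumes "bidual_on R K f" "L \<subseteq> K"
  shows "bidual_on R L f"
  using assms(1) subset_trans[OF _ assms(2)] by (simp add: bidual_on_def)

lemma bidual_on_rescale:
  assumes f: "bidual_on R K f" and r: "0 < r" and L: "\<And>\<phi>. \<phi> \<in> L \<Longrightarrow> \<phi> /\<^sub>R r \<in> K"
  shows "bidual_on R L (\<lambda>\<phi>. r * f (\<phi> /\<^sub>R r))"
  unfolding bidual_on_def
proof (intro allI impI)
  fix F \<epsilon> assume F: "finite F" "F \<subseteq> L" "(0::real) < \<epsilon>"
  have "finite ((\<lambda>\<phi>. \<phi> /\<^sub>R r) ` F)" "(\<lambda>\<phi>. \<phi> /\<^sub>R r) ` F \<subseteq> K" "0 < \<epsilon> / r"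
    using F L r by auto
  then obtain u where u: "norm u \<le> R"
    "\<And>\<psi>. \<psi> \<in> (\<lambda>\<phi>. \<phi> /\<^sub>R r) ` F \<Longrightarrow> \<bar>blinfun_apply \<psi> u - f \<psi>\<bar> \<le> \<epsilon> / r"
    using bidual_onE[OF f] by metis
  have "\<bar>blinfun_apply \<phi> u - r * f (\<phi> /\<^sub>R r)\<bar> \<le> \<epsilon>" if "\<phi> \<in> F" for \<phi>
  proof -
    have "blinfun_apply \<phi> u - r * f (\<phi> /\<^sub>R r) = r * (blinfun_apply (\<phi> /\<^sub>R r) u - f (\<phi> /\<^sub>R r))"
      using r by (simp add: blinfun.scaleR_left algebra_simps)
    also have "\<bar>\<dots>\<bar> \<le> r * (\<epsilon> / r)"
      unfolding abs_mult using u(2)[of "\<phi> /\<^sub>R r"] that r by (intro mult_mono) auto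
    finally show ?thesis
      using r by simp
  qed
  then show "\<exists>u. norm u \<le> R \<and> (\<forall>\<phi>\<in>F. \<bar>blinfun_apply \<phi> u - r * f (\<phi> /\<^sub>R r)\<bar> \<le> \<epsilon>)"
    using u(1) by blast
qed

text \<open>The approximating vectors \<open>u\<close> lie in one ball, so evaluations at them are equicontinuous for the
  norm, and a linear combination \<open>\<psi>\<close> of elements of \<open>Q\<close> near \<open>\<phi>\<close> has \<open>\<psi> u\<close> near both \<open>\<phi> u\<close> and \<open>0\<close>.\<close>

lemma bidual_vanishes_on_closed_span:
  assumes f: "bidual_on R K f" "\<And>\<phi>. \<phi> \<in> Q \<Longrightarrow> f \<phi> = 0" and "Q \<subseteq> K" "\<phi> \<in> K" "\<phi> \<in> closure (span Q)"
  shows "f \<phi> = 0"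
proof -
  have "\<bar>f \<phi>\<bar> \<le> e" if e: "0 < e" for e
  proof -
    \<comment> \<open>Three errors of \<open>e / 3\<close>: from \<open>\<phi>\<close> to \<open>\<psi>\<close>, from \<open>f\<close> to \<open>u\<close> on \<open>Q\<close>, and from \<open>f\<close> to \<open>u\<close> at \<open>\<phi>\<close>.\<close>
    define \<eta> where "\<eta> = e / (3 * (\<bar>R\<bar> + 1))"
    have "0 < \<eta>" "\<eta> * \<bar>R\<bar> \<le> e / 3"
      using e by (auto simp: \<eta>_def field_simps)
    obtain \<psi> where \<psi>: "\<psi> \<in> span Q" "norm (\<psi> - \<phi>) < \<eta>"
      using assms(5) \<open>0 < \<eta>\<close> by (auto simp: closure_approachable dist_norm)
    obtain F a where F: "finite F" "F \<subseteq> Q" "\<psi> = (\<Sum>\<kappa>\<in>F. a \<kappa> *\<^sub>R \<kappa>)"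
      using \<psi>(1) unfolding span_explicit by blast
    define \<epsilon> where "\<epsilon> = e / 3 / (1 + (\<Sum>\<kappa>\<in>F. \<bar>a \<kappa>\<bar>))"
    have S: "0 \<le> (\<Sum>\<kappa>\<in>F. \<bar>a \<kappa>\<bar>)"
      by (simp add: sum_nonneg)
    then have "1 + (\<Sum>\<kappa>\<in>F. \<bar>a \<kappa>\<bar>) \<noteq> 0"
      by linarith
    then have "\<epsilon> * (1 + (\<Sum>\<kappa>\<in>F. \<bar>a \<kappa>\<bar>)) = e / 3"
      by (rule iffD1[OF nonzero_eq_divide_eq \<epsilon>_def])
    moreover have "0 < \<epsilon>"
      using e S by (simp add: \<epsilon>_def add_pos_nonneg)
    moreover from this S have "0 \<le> \<epsilon> * (\<Sum>\<kappa>\<in>F. \<bar>a \<kappa>\<bar>)"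
      by (intro mult_nonneg_nonneg) auto
    ultimately have \<epsilon>: "0 < \<epsilon>" "\<epsilon> \<le> e / 3" "\<epsilon> * (\<Sum>\<kappa>\<in>F. \<bar>a \<kappa>\<bar>) \<le> e / 3"
      unfolding distrib_left mult_1_right by linarith+
    have "finite (insert \<phi> F)" "insert \<phi> F \<subseteq> K"
      using F assms(3,4) by auto
    then obtain u where u: "norm u \<le> R"
      "\<And>\<kappa>. \<kappa> \<in> insert \<phi> F \<Longrightarrow> \<bar>blinfun_apply \<kappa> u - f \<kappa>\<bar> \<le> \<epsilon>"
      using bidual_onE[OF f(1)] \<epsilon>(1) by metis
    have "\<bar>\<psi> u\<bar> \<le> (\<Sum>\<kappa>\<in>F. \<bar>a \<kappa>\<bar> * \<epsilon>)"
      unfolding F(3) blinfun.sum_left blinfun.scaleR_left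
    proof (rule order_trans[OF sum_abs sum_mono])
      fix \<kappa> assume "\<kappa> \<in> F"
      then have "\<bar>\<kappa> u\<bar> \<le> \<epsilon>"
        using u(2)[of \<kappa>] f(2)[of \<kappa>] F(2) by auto
      then show "\<bar>a \<kappa> *\<^sub>R \<kappa> u\<bar> \<le> \<bar>a \<kappa>\<bar> * \<epsilon>"
        by (simp add: abs_mult mult_left_mono)
    qed
    also have "\<dots> = \<epsilon> * (\<Sum>\<kappa>\<in>F. \<bar>a \<kappa>\<bar>)"
      by (simp add: sum_distrib_left mult.commute)
    finally have "\<bar>\<psi> u\<bar> \<le> e / 3"
      using \<epsilon>(3) by linarith
    moreover have "\<bar>\<psi> u - \<phi> u\<bar> \<le> e / 3"
    proof -
      have "\<bar>(\<psi> - \<phi>) u\<bar> \<le> norm (\<psi> - \<phi>) * norm u"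
        using norm_blinfun[of "\<psi> - \<phi>" u] by simp
      also have "\<dots> \<le> \<eta> * \<bar>R\<bar>"
        using \<psi>(2) u(1) \<open>0 < \<eta>\<close> by (intro mult_mono) auto
      finally show ?thesis
        using \<open>\<eta> * \<bar>R\<bar> \<le> e / 3\<close> by (simp add: blinfun.diff_left)
    qed
    moreover have "\<bar>\<phi> u - f \<phi>\<bar> \<le> e / 3"
      using u(2)[of \<phi>] \<epsilon>(2) by auto
    ultimately show ?thesis
      by linarith
  qed
  then have "\<bar>f \<phi>\<bar> \<le> 0"
    by (rule field_le_epsilon) simp
  then show ?thesis
    by simp
qed

section \<open>Bidual functions on weak-star closed convex hulls\<close>

lemma mean_of_convex_hull:
  fixes Y :: "('v::real_normed_vector \<Rightarrow>\<^sub>L real) set"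
  assumes "bounded Y" "\<phi> \<in> convex hull Y"
  shows "\<exists>m. mean_on Y m \<and> (\<forall>v. m (\<lambda>y. y v) = \<phi> v)"
proof -
  let ?P = "\<lambda>\<phi>. \<exists>m. mean_on Y m \<and> (\<forall>v. m (\<lambda>y. blinfun_apply y v) = blinfun_apply \<phi> v)"
  have "convex hull Y \<subseteq> Collect ?P"
  proof (rule hull_minimal)
    show "Y \<subseteq> Collect ?P"
    proof
      fix y assume "y \<in> Y"
      from mean_on_point[OF this] show "y \<in> Collect ?P"
        by (intro CollectI exI[of _ "\<lambda>f. f y"]) simp
    qed
    show "convex (Collect ?P)"
    proof (rule convexI)
      fix \<phi> \<psi> and s t :: real
      assume st: "0 \<le> s" "0 \<le> t" "s + t = 1" and "\<phi> \<in> Collect ?P" "\<psi> \<in> Collect ?P"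
      then obtain m n where m: "mean_on Y m" "\<And>v. m (\<lambda>y. blinfun_apply y v) = \<phi> v"
        and n: "mean_on Y n" "\<And>v. n (\<lambda>y. blinfun_apply y v) = \<psi> v"
        by blast
      show "s *\<^sub>R \<phi> + t *\<^sub>R \<psi> \<in> Collect ?P"
        using mean_on_convex_combination[OF m(1) n(1) st] m(2) n(2)
        by (auto simp: blinfun.add_left blinfun.scaleR_left)
    qed
  qed
  then show ?thesis
    using assms(2) by auto
qed

lemma bounded_eval:
  assumes "bounded (Y :: ('v::real_normed_vector \<Rightarrow>\<^sub>L real) set)"
  shows "bounded ((\<lambda>y. blinfun_apply y v) ` Y)"
  using assms by (rule bounded_linear_image) (rule blinfun.bounded_linear_left)

text \<open>A convex combination of points gives a finitely supported mean; a limit of convex combinations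
  gives a limit of such means.\<close>

lemma mean_of_weak_star_closed_convex_hull:
  fixes Y :: "('v::real_normed_vector \<Rightarrow>\<^sub>L real) set"
  assumes "bounded Y" "\<phi> \<in> weak_star_topology closure_of (convex hull Y)"
  obtains m :: "(('v \<Rightarrow>\<^sub>L real) \<Rightarrow> real) \<Rightarrow> real"
    where "mean_on Y m" "\<And>v. m (\<lambda>y. blinfun_apply y v) = \<phi> v"
proof (rule mean_with_prescribed_values[where e = "\<lambda>v y. blinfun_apply y v" and t = "blinfun_apply \<phi>"])
  fix D :: "'v set" and \<epsilon> :: real
  assume "finite D" "0 < \<epsilon>"
  then obtain \<psi> where "\<psi> \<in> convex hull Y" "\<And>v. v \<in> D \<Longrightarrow> \<bar>\<psi> v - \<phi> v\<bar> \<le> \<epsilon>"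
    using weak_star_closure_approx[OF assms(2)] by metis
  then show "\<exists>m. mean_on Y m \<and> (\<forall>v\<in>D. \<bar>m (\<lambda>y. blinfun_apply y v) - \<phi> v\<bar> \<le> \<epsilon>)"
    using mean_of_convex_hull[OF assms(1), of \<psi>] by auto
next
  show "bounded ((\<lambda>y. blinfun_apply y v) ` Y)" for v
    by (rule bounded_eval[OF assms(1)])
next
  fix m assume "mean_on Y m" "\<And>v. m (\<lambda>y. blinfun_apply y v) = \<phi> v"
  then show thesis by (rule that)
qed

text \<open>Haydon's theorem in the form needed here: if \<open>f \<phi> \<noteq> 0\<close>, the vectors that approximate \<open>f\<close> are
  small at finite subsets of \<open>Y\<close> while their value at \<open>\<phi>\<close>, which is their mean, stays away from \<open>0\<close>.
  This is an oscillating filter, and it produces a copy of \<open>l\<^sub>1\<close>.\<close>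

lemma bidual_vanishes_on_closed_convex_hull:
  fixes Y :: "('v::banach \<Rightarrow>\<^sub>L real) set"
  assumes ros: "rosenthal_space TYPE('v)"
    and Y: "compactin weak_star_topology Y" "bounded Y"
    and \<phi>: "\<phi> \<in> weak_star_topology closure_of (convex hull Y)"
    and f: "bidual_on R (insert \<phi> Y) f" "\<And>y. y \<in> Y \<Longrightarrow> f y = 0"
  shows "f \<phi> = 0"
proof (rule ccontr)
  assume "f \<phi> \<noteq> 0"
  define c where "c = \<bar>f \<phi>\<bar> / 2"
  have c: "0 < c"
    using \<open>f \<phi> \<noteq> 0\<close> by (simp add: c_def)
  define V where "V = {u. norm u \<le> R \<and> c \<le> \<phi> u}"
  define U where "U = (\<lambda>(F :: ('v \<Rightarrow>\<^sub>L real) set) k. {u \<in> V. \<forall>y\<in>F. \<bar>blinfun_apply y u\<bar> \<le> k})"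
  define ev where "ev = (\<lambda>u (y :: 'v \<Rightarrow>\<^sub>L real). y u)"
  define \<A> where "\<A> = {ev ` U F k |F k. finite F \<and> F \<subseteq> Y \<and> 0 < k}"
  obtain r where r: "0 < r" "\<And>y. y \<in> Y \<Longrightarrow> norm y \<le> r"
    using Y(2) bounded_pos by metis
  obtain m :: "(('v \<Rightarrow>\<^sub>L real) \<Rightarrow> real) \<Rightarrow> real"
    where m: "mean_on Y m" "\<And>v. m (\<lambda>y. blinfun_apply y v) = \<phi> v"
    by (rule mean_of_weak_star_closed_convex_hull[OF Y(2) \<phi>]) (rule that)
  have U_ne: "U F k \<noteq> {}" if F: "finite F" "F \<subseteq> Y" "0 < k" for F k
  proof -
    have "finite (insert \<phi> F)" "insert \<phi> F \<subseteq> insert \<phi> Y" "0 < min k c"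
      using F c by auto
    then obtain u where u: "norm u \<le> R"
      "\<And>\<psi>. \<psi> \<in> insert \<phi> F \<Longrightarrow> \<bar>blinfun_apply \<psi> u - f \<psi>\<bar> \<le> min k c"
      using bidual_onE[OF f(1)] by metis
    have "\<bar>y u\<bar> \<le> k" if "y \<in> F" for y
      using u(2)[of y] f(2)[of y] that F(2) by auto
    moreover have "c \<le> sgn (f \<phi>) * \<phi> u"
      using u(2)[of \<phi>] \<open>f \<phi> \<noteq> 0\<close> unfolding c_def by (auto simp: sgn_if abs_if split: if_splits)
    \<comment> \<open>The sign turns a value of \<open>\<phi>\<close> far from zero into a value above \<open>c\<close>.\<close>
    ultimately have "sgn (f \<phi>) *\<^sub>R u \<in> U F k"
      using u(1) \<open>f \<phi> \<noteq> 0\<close>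
      by (auto simp: U_def V_def blinfun.scaleR_right abs_mult abs_sgn_eq)
    then show ?thesis
      by auto
  qed
  have ev_bound: "\<bar>ev u y\<bar> \<le> r * R" if "u \<in> V" "y \<in> Y" for u y
    using norm_blinfun[of y u] mult_mono[OF r(2)[OF that(2)], of "norm u" R] r(1) that(1)
    unfolding ev_def V_def by simp
  have midpoint: "(\<lambda>y. (g y + h y) / 2) \<in> ev ` U F k" if gh: "g \<in> ev ` U F k" "h \<in> ev ` U F k" for g h F k
  proof -
    obtain u v where uv: "g = ev u" "h = ev v" "u \<in> U F k" "v \<in> U F k"
      using gh by blast
    let ?w = "(1 / 2) *\<^sub>R (u + v)"
    have *: "y ?w = (y u + y v) / 2" for y :: "'v \<Rightarrow>\<^sub>L real"
      by (simp add: blinfun.scaleR_right blinfun.add_right)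
    have "norm ?w \<le> R"
      using uv norm_triangle_ineq[of u v] unfolding U_def V_def by simp
    moreover have "c \<le> \<phi> ?w"
      unfolding * using uv(3,4) unfolding U_def V_def by auto
    moreover have "\<bar>y ?w\<bar> \<le> k" if "y \<in> F" for y
    proof -
      have "\<bar>y u\<bar> \<le> k" "\<bar>y v\<bar> \<le> k"
        using uv(3,4) that unfolding U_def by auto
      then show ?thesis
        unfolding * abs_le_iff by (auto simp: field_simps)
    qed
    ultimately have "?w \<in> U F k"
      unfolding U_def V_def by simp
    moreover have "(\<lambda>y. (g y + h y) / 2) = ev ?w"
      by (simp only: uv(1,2) ev_def *)
    ultimately show ?thesis
      by blast
  qed
  have directed: "\<exists>C\<in>\<A>. C \<subseteq> A \<inter> B" if AB: "A \<in> \<A>" "B \<in> \<A>" for A B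
  proof -
    obtain F k F' k' where *: "A = ev ` U F k" "B = ev ` U F' k'" "finite F" "finite F'"
      "F \<subseteq> Y" "F' \<subseteq> Y" "0 < k" "0 < k'"
      using AB unfolding \<A>_def by blast
    then have "ev ` U (F \<union> F') (min k k') \<in> \<A>"
      unfolding \<A>_def by (auto intro!: exI[of _ "F \<union> F'"] exI[of _ "min k k'"])
    moreover have "ev ` U (F \<union> F') (min k k') \<subseteq> A \<inter> B"
      unfolding * U_def by auto
    ultimately show ?thesis ..
  qed
  have A_memb: "ev ` U F k \<in> \<A>" if "finite F" "F \<subseteq> Y" "0 < k" for F k
    using that unfolding \<A>_def by blast
  obtain G where G: "G \<noteq> bot" "\<And>A. A \<in> \<A> \<Longrightarrow> eventually (\<lambda>f. f \<in> A) G"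
    "\<And>\<eta>. 0 < \<eta> \<Longrightarrow> \<exists>P. eventually P G \<and> (\<forall>f g. P f \<longrightarrow> P g \<longrightarrow> m (\<lambda>y. (f y - g y)\<^sup>2) \<le> \<eta>)"
  proof (rule Cauchy_filter_of_convex_family[OF m(1), of \<A> "r * R"])
    show "\<A> \<noteq> {}"
      using A_memb[of "{}" 1] by auto
    show "A \<noteq> {}" if "A \<in> \<A>" for A
      using that U_ne unfolding \<A>_def by auto
    show "\<exists>C\<in>\<A>. C \<subseteq> A \<inter> B" if "A \<in> \<A>" "B \<in> \<A>" for A B
      using directed that .
    show "(\<lambda>y. (g y + h y) / 2) \<in> A" if "A \<in> \<A>" "g \<in> A" "h \<in> A" for A g h
      using that midpoint unfolding \<A>_def by blast
    show "\<bar>g y\<bar> \<le> r * R" if "A \<in> \<A>" "g \<in> A" "y \<in> Y" for A g y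
      using that ev_bound unfolding \<A>_def U_def by auto
  qed (rule that)
  interpret oscillating_filter weak_star_topology Y m "ev ` V" G "r * R" c
  proof
    show "continuous_map weak_star_topology euclidean g" if "g \<in> ev ` V" for g
      using that continuous_map_weak_star_eval unfolding ev_def by auto
    show "c \<le> m g" if "g \<in> ev ` V" for g
      using that m(2) by (auto simp: ev_def V_def)
    have "U {} 1 = V"
      by (simp add: U_def)
    then show "\<forall>\<^sub>F g in G. g \<in> ev ` V"
      using G(2)[OF A_memb[of "{}" 1]] by simp
    show "\<forall>\<^sub>F g in G. \<bar>g y\<bar> \<le> k" if "y \<in> Y" "0 < k" for y k
      using G(2)[OF A_memb[of "{y}" k]] that
      by (auto elim!: eventually_mono simp: U_def ev_def)
  qed (use m(1) Y(1) c G ev_bound in auto)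
  obtain g :: "nat \<Rightarrow> ('v \<Rightarrow>\<^sub>L real) \<Rightarrow> real" where g: "\<And>n. g n \<in> ev ` V"
    "\<And>\<sigma> N. \<exists>y\<in>Y. \<forall>n<N. if \<sigma> n then c / 3 \<le> g n y else g n y \<le> c / 4"
    using independent_sequence by blast
  have "\<forall>n. \<exists>u. u \<in> V \<and> g n = ev u"
    using g(1) by blast
  then obtain u where "\<forall>n. u n \<in> V \<and> g n = ev (u n)"
    by (rule choice[THEN exE])
  then have u: "u n \<in> V" "g n = ev (u n)" for n
    by auto
  have "l1_embedding (\<lambda>a. \<Sum>n. a n *\<^sub>R u n)"
  proof (rule l1_embedding_of_independent)
    show "norm (u n) \<le> R" for n
      using u(1)[of n] by (simp add: V_def)
    show "\<exists>y\<in>Y. \<forall>n<N. if \<sigma> n then c / 3 \<le> blinfun_apply y (u n) else blinfun_apply y (u n) \<le> c / 4"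
      for \<sigma> N
      using g(2)[where \<sigma> = \<sigma> and N = N] by (simp only: u(2) ev_def)
  qed (use r c in auto)
  then show False
    using ros unfolding rosenthal_space_def by blast
qed

section \<open>Enveloping semigroups\<close>

lemma closure_of_invariant:
  assumes "continuous_map T T f" "f ` S \<subseteq> S" "x \<in> T closure_of S"
  shows "f x \<in> T closure_of S"
  by (rule subsetD[OF order_trans[OF continuous_map_image_closure_subset[OF assms(1)]
        closure_of_mono[OF assms(2)]] imageI[OF assms(3)]])

lemma enveloping_semigroup_closed_under:
  assumes "closedin (product_topology (\<lambda>_. K) (topspace K)) C"
    and "\<And>s. restrict (act s) (topspace K) \<in> C" "p \<in> enveloping_semigroup act K"
  shows "p \<in> C"
  using assms closure_of_minimal[of "range (\<lambda>s. restrict (act s) (topspace K))" C]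
  unfolding enveloping_semigroup_def by blast

text \<open>The map is continuous on a compact space and sends translations to translations, so its image
  is closed and contains them densely; injectivity is all that is left.  The homeomorphism \<open>j\<close> with
  inverse \<open>c\<close> allows for a change of scale between the two spaces, and is the identity when \<open>B\<close> is
  just a subspace of \<open>A\<close>.\<close>

lemma enveloping_iso_of_injective:
  fixes act :: "'s \<Rightarrow> 'k \<Rightarrow> 'k"
  assumes T: "Hausdorff_space T" and A: "compactin T A" and B: "compactin T B"
    and actA: "\<And>s x. x \<in> A \<Longrightarrow> act s x \<in> A" and actB: "\<And>s x. x \<in> B \<Longrightarrow> act s x \<in> B"
    and jc: "homeomorphic_maps T T j c" and equiv: "\<And>s x. x \<in> B \<Longrightarrow> act s (j x) = j (act s x)"
    and jB: "j ` B \<subseteq> A"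
    and inj: "inj_on (\<lambda>p. \<lambda>x\<in>B. c (p (j x))) (enveloping_semigroup act (subtopology T A))"
  shows "enveloping_iso act (subtopology T A) (subtopology T B) (\<lambda>p. \<lambda>x\<in>B. c (p (j x)))"
proof -
  define g where "g = (\<lambda>p. \<lambda>x\<in>B. c (p (j x)))"
  let ?K = "subtopology T A" and ?L = "subtopology T B"
  let ?PK = "product_topology (\<lambda>_. ?K) A" and ?PL = "product_topology (\<lambda>_. ?L) B"
  let ?EK = "enveloping_semigroup act ?K" and ?EL = "enveloping_semigroup act ?L"
  have top: "topspace ?K = A" "topspace ?L = B"
    using A B compactin_subset_topspace by (auto simp: topspace_subtopology_subset)
  have AT: "A \<subseteq> topspace T" "B \<subseteq> topspace T"
    using A B compactin_subset_topspace by auto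
  have j: "continuous_map T T j" "continuous_map T T c" "\<And>x. x \<in> topspace T \<Longrightarrow> c (j x) = x"
    "\<And>x. x \<in> topspace T \<Longrightarrow> j (c x) = x"
    using jc unfolding homeomorphic_maps_def by auto
  have EK: "?EK = ?PK closure_of range (\<lambda>s. restrict (act s) A)"
    and EL: "?EL = ?PL closure_of range (\<lambda>s. restrict (act s) B)"
    unfolding enveloping_semigroup_def top by auto
  have sub_PK: "range (\<lambda>s. restrict (act s) A) \<subseteq> topspace ?PK"
    and sub_PL: "range (\<lambda>s. restrict (act s) B) \<subseteq> topspace ?PL"
    using actA actB AT by (auto simp: top)
  have Hausdorff_PL: "Hausdorff_space ?PL"
    by (simp add: Hausdorff_space_product_topology Hausdorff_space_subtopology T)
  have compact_PK: "compact_space ?PK"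
    by (simp add: compact_space_product_topology A compact_space_subtopology)
  have p_A: "p x \<in> A" if "p \<in> ?EK" "x \<in> A" for p x
    using that closure_of_subset_topspace[of ?PK] unfolding EK by (fastforce simp: top)
  have p_jB: "p (j x) \<in> j ` B" if "p \<in> ?EK" "x \<in> B" for p x
  proof -
    have jx: "j x \<in> A"
      using jB that(2) by auto
    have "compactin ?K (j ` B)"
      using image_compactin[OF B j(1)] jB by (simp add: compactin_subtopology)
    then have "closedin ?K (j ` B)"
      using compactin_imp_closedin Hausdorff_space_subtopology[OF T] by blast
    then have cl: "closedin ?PK {q \<in> topspace ?PK. q (j x) \<in> j ` B}"
      by (rule closedin_continuous_map_preimage[OF continuous_map_product_projection[OF jx]])
    have mem: "restrict (act s) A \<in> {q \<in> topspace ?PK. q (j x) \<in> j ` B}" for s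
    proof -
      have "restrict (act s) A \<in> topspace ?PK"
        using sub_PK by blast
      moreover have "restrict (act s) A (j x) \<in> j ` B"
        using jx equiv[OF that(2)] actB[OF that(2)] by simp
      ultimately show ?thesis
        by blast
    qed
    show ?thesis
      using enveloping_semigroup_closed_under[where K = ?K, unfolded top, OF cl mem that(1)] by blast
  qed
  have c_B: "c (p (j x)) \<in> B" if "p \<in> ?EK" "x \<in> B" for p x
    using p_jB[OF that] j(3) AT by auto
  have g_act: "g (restrict (act s) A) = restrict (act s) B" for s
    using jB equiv j(3) AT actB by (auto simp: g_def fun_eq_iff restrict_def) blast
  have top_E: "topspace (enveloping_topology act ?K) = ?EK" "topspace (enveloping_topology act ?L) = ?EL"
    by (simp_all only: enveloping_topology_def top EK EL topspace_subtopology_subset closure_of_subset_topspace)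
  have cont: "continuous_map (subtopology ?PK ?EK) ?PL g"
    unfolding continuous_map_componentwise
  proof (intro conjI ballI)
    fix x assume x: "x \<in> B"
    then have jx: "j x \<in> A"
      using jB by auto
    have "continuous_map ?PK T (\<lambda>p. p (j x))"
      using continuous_map_product_projection[OF jx, of "\<lambda>_. ?K"] continuous_map_into_fulltopology by blast
    then have "continuous_map ?PK T (\<lambda>p. c (p (j x)))"
      using continuous_map_compose[OF _ j(2), unfolded comp_def] by blast
    then have "continuous_map (subtopology ?PK ?EK) T (\<lambda>p. c (p (j x)))"
      by (rule continuous_map_from_subtopology)
    then have "continuous_map (subtopology ?PK ?EK) ?L (\<lambda>p. c (p (j x)))"
      by (rule continuous_map_into_subtopology) (use c_B x in auto)
    then show "continuous_map (subtopology ?PK ?EK) ?L (\<lambda>p. g p x)"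
      using x by (simp add: g_def)
  qed (auto simp: g_def)
  have compact_EK: "compactin ?PK ?EK"
    unfolding EK by (rule closedin_compact_space[OF compact_PK]) simp
  have "compactin ?PL (g ` ?EK)"
    by (rule image_compactin[OF _ cont]) (simp add: compactin_subtopology compact_EK)
  then have closed: "closedin ?PL (g ` ?EK)"
    using compactin_imp_closedin Hausdorff_PL by blast
  have img: "g ` ?EK = ?EL"
  proof
    have act_EK: "restrict (act s) A \<in> ?EK" for s
      unfolding EK using closure_of_subset[OF sub_PK] by auto
    show "?EL \<subseteq> g ` ?EK"
      unfolding EL
    proof (rule closure_of_minimal[OF _ closed])
      show "range (\<lambda>s. restrict (act s) B) \<subseteq> g ` ?EK"
        using act_EK g_act by (metis image_eqI image_subsetI)
    qed
    have "g ` (subtopology ?PK ?EK closure_of range (\<lambda>s. restrict (act s) A))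
        \<subseteq> ?PL closure_of (g ` range (\<lambda>s. restrict (act s) A))"
      using cont by (rule continuous_map_image_closure_subset)
    moreover have "subtopology ?PK ?EK closure_of range (\<lambda>s. restrict (act s) A) = ?EK"
    proof -
      have "?EK \<inter> range (\<lambda>s. restrict (act s) A) = range (\<lambda>s. restrict (act s) A)"
        using act_EK by auto
      then show ?thesis
        by (simp only: closure_of_subtopology EK Int_absorb)
    qed
    ultimately show "g ` ?EK \<subseteq> ?EL"
      unfolding EL by (simp add: image_image g_act)
  qed
  have "homeomorphic_map (enveloping_topology act ?K) (enveloping_topology act ?L) g"
  proof (rule continuous_imp_homeomorphic_map)
    show "continuous_map (enveloping_topology act ?K) (enveloping_topology act ?L) g"
      using cont img unfolding enveloping_topology_def top
      by (auto intro!: continuous_map_into_subtopology dest: subsetD[OF equalityD1[OF img]])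
    show "compact_space (enveloping_topology act ?K)"
      using compact_EK unfolding enveloping_topology_def top by (rule compact_space_subtopology)
    show "Hausdorff_space (enveloping_topology act ?L)"
      unfolding enveloping_topology_def top by (rule Hausdorff_space_subtopology[OF Hausdorff_PL])
  qed (use inj img in \<open>simp_all add: top_E g_def\<close>)
  moreover have "g (compose A p q) = compose B (g p) (g q)" if "p \<in> ?EK" "q \<in> ?EK" for p q
  proof
    fix x
    show "g (compose A p q) x = compose B (g p) (g q) x"
    proof (cases "x \<in> B")
      case True
      then have "j (c (q (j x))) = q (j x)"
        using p_A[OF that(2)] jB AT by (intro j(4)) auto
      then show ?thesis
        using True jB c_B[OF that(2)] by (auto simp: g_def compose_def)
    qed (simp add: g_def compose_def)
  qed
  ultimately show ?thesis
    unfolding enveloping_iso_def g_def[symmetric] top by blast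
qed

text \<open>On a finite set, \<open>p\<close> and \<open>q\<close> are close to translations by some \<open>s\<close> and \<open>t\<close>; the vector
  \<open>h s v - h t v\<close> then approximates the difference.\<close>

lemma bidual_on_enveloping_difference:
  fixes h :: "'s \<Rightarrow> ('v::real_normed_vector \<Rightarrow>\<^sub>L 'v)"
  assumes h: "\<And>s. norm (h s) \<le> 1"
    and pq: "p \<in> enveloping_semigroup (dual_action h) (subtopology weak_star_topology A)"
      "q \<in> enveloping_semigroup (dual_action h) (subtopology weak_star_topology A)"
  shows "bidual_on (2 * norm v) A (\<lambda>\<phi>. p \<phi> v - q \<phi> v)"
  unfolding bidual_on_def
proof (intro allI impI)
  fix F \<epsilon> assume F: "finite F" "F \<subseteq> A" and \<epsilon>: "(0::real) < \<epsilon>"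
  let ?K = "subtopology weak_star_topology A"
  let ?P = "product_topology (\<lambda>_. ?K) A"
  have near: "\<exists>s. \<forall>\<phi>\<in>F. \<bar>blinfun_apply \<phi> (h s v) - p \<phi> v\<bar> \<le> \<epsilon> / 2"
    if p: "p \<in> enveloping_semigroup (dual_action h) ?K" for p
  proof -
    let ?U = "\<lambda>\<phi>. {q \<in> topspace ?P. q \<phi> v \<in> ball (p \<phi> v) (\<epsilon> / 2)}"
    have "openin ?P (?U \<phi>)" if "\<phi> \<in> F" for \<phi>
    proof -
      have "continuous_map ?P weak_star_topology (\<lambda>q. q \<phi>)"
        using continuous_map_product_projection[of \<phi> A "\<lambda>_. ?K"] that F(2) continuous_map_into_fulltopology
        by blast
      from continuous_map_compose[OF this continuous_map_weak_star_eval[of v]]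
      show ?thesis
        by (intro openin_continuous_map_preimage) (auto simp: comp_def)
    qed
    then have "openin ?P ((\<Inter>\<phi>\<in>F. ?U \<phi>) \<inter> topspace ?P)"
      by (rule openin_INT[OF F(1)])
    moreover have "p \<in> ?P closure_of range (\<lambda>s. restrict (dual_action h s) A)"
      using p by (simp add: enveloping_semigroup_def)
    moreover from this have "p \<in> (\<Inter>\<phi>\<in>F. ?U \<phi>) \<inter> topspace ?P"
      using \<epsilon> closure_of_subset_topspace[of ?P] by auto
    ultimately obtain s where "restrict (dual_action h s) A \<in> (\<Inter>\<phi>\<in>F. ?U \<phi>) \<inter> topspace ?P"
      unfolding in_closure_of by blast
    then have close: "blinfun_apply (restrict (dual_action h s) A \<phi>) v \<in> ball (p \<phi> v) (\<epsilon> / 2)" if "\<phi> \<in> F" for \<phi>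
      using that by blast
    have "\<bar>blinfun_apply \<phi> (h s v) - p \<phi> v\<bar> \<le> \<epsilon> / 2" if "\<phi> \<in> F" for \<phi>
      using close[OF that] subsetD[OF F(2) that]
      by (simp add: dual_action_def dist_real_def abs_minus_commute)
    then show ?thesis
      by blast
  qed
  obtain s t where st: "\<forall>\<phi>\<in>F. \<bar>blinfun_apply \<phi> (h s v) - p \<phi> v\<bar> \<le> \<epsilon> / 2" "\<forall>\<phi>\<in>F. \<bar>blinfun_apply \<phi> (h t v) - q \<phi> v\<bar> \<le> \<epsilon> / 2"
    using near[OF pq(1)] near[OF pq(2)] by blast
  have hv: "norm (h s v) \<le> norm v" for s
    using norm_blinfun[of "h s" v] mult_right_mono[OF h[of s] norm_ge_zero[of v]] by simp
  have "norm (h s v - h t v) \<le> 2 * norm v"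
    using norm_triangle_ineq4[of "h s v" "h t v"] hv[of s] hv[of t] by linarith
  moreover have "\<bar>blinfun_apply \<phi> (h s v - h t v) - (p \<phi> v - q \<phi> v)\<bar> \<le> \<epsilon>" if "\<phi> \<in> F" for \<phi>
    using st that by (simp add: blinfun.diff_right) (smt (verit) field_sum_of_halves)
  ultimately show "\<exists>u. norm u \<le> 2 * norm v \<and> (\<forall>\<phi>\<in>F. \<bar>blinfun_apply \<phi> u - (p \<phi> v - q \<phi> v)\<bar> \<le> \<epsilon>)"
    by blast
qed

lemma enveloping_semigroup_eqI:
  assumes "p \<in> enveloping_semigroup act (subtopology weak_star_topology A)"
    "q \<in> enveloping_semigroup act (subtopology weak_star_topology A)"
    and "\<And>\<phi> v. \<phi> \<in> A \<Longrightarrow> blinfun_apply (p \<phi>) v = q \<phi> v"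
  shows "p = q"
proof
  fix \<phi>
  let ?P = "product_topology (\<lambda>_. subtopology weak_star_topology A) A"
  have "enveloping_semigroup act (subtopology weak_star_topology A) \<subseteq> topspace ?P"
    by (simp only: enveloping_semigroup_def topspace_subtopology topspace_weak_star Int_UNIV_left
        closure_of_subset_topspace)
  then have ext: "p \<in> extensional A" "q \<in> extensional A"
    using assms(1,2) by (auto simp: PiE_def)
  show "p \<phi> = q \<phi>"
  proof (cases "\<phi> \<in> A")
    case True
    then show ?thesis
      by (intro blinfun_eqI assms(3))
  next
    case False
    then show ?thesis
      by (simp only: extensional_arb[OF ext(1) False] extensional_arb[OF ext(2) False])
  qed
qed

section \<open>Compatibility of representations on Rosenthal spaces\<close>

theorem theorem8p1:
  fixes act :: "'s::semitopological_monoid \<Rightarrow> 'x \<Rightarrow> 'x"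
    and X :: "'x topology"
    and h :: "'s \<Rightarrow> ('v::banach \<Rightarrow>\<^sub>L 'v)"
    and \<alpha> :: "'x \<Rightarrow> ('v \<Rightarrow>\<^sub>L real)"
  assumes "S_space act X"
    and "rosenthal_space TYPE('v)"
    and "weakly_continuous_representation act X h \<alpha>"
  shows "E_compatible X h \<alpha> \<and> (w_star_generating X \<alpha> \<longrightarrow> strongly_E_compatible X h \<alpha>)"
proof -
  define ws where "ws = (weak_star_topology :: ('v \<Rightarrow>\<^sub>L real) topology)"
  define Z where "Z = \<alpha> ` topspace X"
  define Y where "Y = rep_Y X \<alpha>"
  define Q where "Q = rep_Q X \<alpha>"
  have YQ: "Y = ws closure_of Z" "Q = ws closure_of (convex hull Z)"
    by (simp_all add: Y_def Q_def rep_Y_def rep_Q_def Z_def ws_def)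
  have top [simp]: "topspace ws = UNIV"
    by (simp add: ws_def)
  have Haus: "Hausdorff_space ws"
    unfolding ws_def by (rule Hausdorff_weak_star)
  have cball: "compactin ws (cball 0 r)" for r
    unfolding ws_def by (rule compactin_weak_star_cball)
  have h: "norm (h s) \<le> 1" for s
  proof -
    have "h s \<in> topspace (subtopology weak_operator_topology Theta)"
      using assms(3) unfolding weakly_continuous_representation_def continuous_map_def by auto
    then show ?thesis
      by (simp add: Theta_def)
  qed
  have cont: "continuous_map ws ws (dual_action h s)" for s
    unfolding ws_def by (rule continuous_map_dual_action)
  have "bounded Z"
    using assms(3) by (simp add: weakly_continuous_representation_def Z_def)
  then obtain r\<^sub>0 where "0 < r\<^sub>0" "\<forall>\<phi>\<in>Z. norm \<phi> \<le> r\<^sub>0"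
    unfolding bounded_pos by blast
  then have r0: "0 < r\<^sub>0" "Z \<subseteq> cball 0 r\<^sub>0"
    by auto
  have Q_cball: "Q \<subseteq> cball 0 r\<^sub>0"
    unfolding YQ
  proof (rule closure_of_minimal)
    show "convex hull Z \<subseteq> cball 0 r\<^sub>0"
      using r0(2) by (rule hull_minimal) simp
    show "closedin ws (cball 0 r\<^sub>0)"
      using Haus cball by (rule compactin_imp_closedin)
  qed
  have "Y \<subseteq> Q"
    unfolding YQ by (intro closure_of_mono hull_subset)
  have Q: "compactin ws Q"
    using closed_compactin[OF cball Q_cball] by (simp add: YQ)
  have Y: "compactin ws Y"
    using closed_compactin[OF Q \<open>Y \<subseteq> Q\<close>] by (simp add: YQ)
  have bdd: "bounded Y"
    by (rule bounded_subset[OF bounded_cball order_trans[OF \<open>Y \<subseteq> Q\<close> Q_cball]])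
  have Q_hull: "Q \<subseteq> ws closure_of (convex hull Y)"
    unfolding YQ(2) by (intro closure_of_mono hull_mono) (simp add: YQ closure_of_subset)
  have inv_Z: "dual_action h s ` Z \<subseteq> Z" for s
  proof -
    have "act s x \<in> topspace X" if "x \<in> topspace X" for x
      using assms(1) that unfolding S_space_def continuous_map_def by auto
    moreover have "dual_action h s (\<alpha> x) = \<alpha> (act s x)" if "x \<in> topspace X" for x
      using assms(3) that unfolding weakly_continuous_representation_def by simp
    ultimately show ?thesis
      by (auto simp: Z_def)
  qed
  have inv_hull: "dual_action h s ` (convex hull Z) \<subseteq> convex hull Z" for s
    unfolding convex_hull_linear_image[OF linear_dual_action] by (rule hull_mono[OF inv_Z])
  have inv: "dual_action h s \<phi> \<in> Y" if "\<phi> \<in> Y" for s \<phi>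
    using closure_of_invariant[OF cont inv_Z] that unfolding YQ .
  have inv': "dual_action h s \<phi> \<in> Q" if "\<phi> \<in> Q" for s \<phi>
    using closure_of_invariant[OF cont inv_hull] that unfolding YQ .

  \<comment> \<open>Here the absence of \<open>l\<^sub>1\<close> in \<open>V\<close> enters, for both parts.\<close>
  have vanish: "f \<phi> = 0"
    if "bidual_on R L f" "Q \<subseteq> L" "\<And>y. y \<in> Y \<Longrightarrow> f y = 0" "\<phi> \<in> Q" for R L f \<phi>
  proof (rule bidual_vanishes_on_closed_convex_hull[OF assms(2) Y[unfolded ws_def] bdd])
    show "\<phi> \<in> weak_star_topology closure_of (convex hull Y)"
      using subsetD[OF Q_hull that(4)] by (simp only: ws_def)
    show "bidual_on R (insert \<phi> Y) f"
      using that(1) by (rule bidual_on_subset) (use that(2,4) \<open>Y \<subseteq> Q\<close> in auto)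
  qed (rule that(3))

  have "E_compatible X h \<alpha>"
  proof -
    have "inj_on (\<lambda>p. \<lambda>x\<in>Y. p x) (enveloping_semigroup (dual_action h) (subtopology ws Q))"
    proof (rule inj_onI)
      fix p q
      assume pq: "p \<in> enveloping_semigroup (dual_action h) (subtopology ws Q)"
        "q \<in> enveloping_semigroup (dual_action h) (subtopology ws Q)"
        and eq: "(\<lambda>x\<in>Y. p x) = (\<lambda>x\<in>Y. q x)"
      show "p = q"
      proof (rule enveloping_semigroup_eqI[OF pq[unfolded ws_def]])
        fix \<phi> v assume "\<phi> \<in> Q"
        have "p y = q y" if "y \<in> Y" for y
          using fun_cong[OF eq, of y] that by simp
        then have "p \<phi> v - q \<phi> v = 0"
          by (intro vanish[OF bidual_on_enveloping_difference[OF h pq[unfolded ws_def]] order_refl _ \<open>\<phi> \<in> Q\<close>]) simp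
        then show "p \<phi> v = q \<phi> v"
          by simp
      qed
    qed
    moreover have "homeomorphic_maps ws ws (\<lambda>x. x) (\<lambda>x. x)"
      by (simp add: homeomorphic_maps_def)
    ultimately have "enveloping_iso (dual_action h) (subtopology ws Q) (subtopology ws Y) (\<lambda>p. \<lambda>x\<in>Y. p x)"
      using \<open>Y \<subseteq> Q\<close> inv inv' by (intro enveloping_iso_of_injective[OF Haus Q Y]) auto
    then show ?thesis
      by (simp add: E_compatible_def ws_def Y_def Q_def)
  qed

  moreover have "strongly_E_compatible X h \<alpha>" if "w_star_generating X \<alpha>"
    unfolding strongly_E_compatible_def Y_def[symmetric] Q_def[symmetric] ws_def[symmetric]
  proof (intro conjI allI impI)
    show "\<exists>r>0. Q \<subseteq> cball 0 r"
      using r0(1) Q_cball by blast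
    fix r :: real
    assume r: "0 < r" "Q \<subseteq> cball 0 r"
    have dense: "closure (span Q) = UNIV"
      using that by (simp add: w_star_generating_def Q_def)
    have "inj_on (\<lambda>p. \<lambda>x\<in>Y. r *\<^sub>R p (x /\<^sub>R r))
        (enveloping_semigroup (dual_action h) (subtopology ws (cball 0 1)))"
    proof (rule inj_onI)
      fix p q
      assume pq: "p \<in> enveloping_semigroup (dual_action h) (subtopology ws (cball 0 1))"
        "q \<in> enveloping_semigroup (dual_action h) (subtopology ws (cball 0 1))"
        and eq: "(\<lambda>x\<in>Y. r *\<^sub>R p (x /\<^sub>R r)) = (\<lambda>x\<in>Y. r *\<^sub>R q (x /\<^sub>R r))"
      show "p = q"
      proof (rule enveloping_semigroup_eqI[OF pq[unfolded ws_def]])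
        fix \<psi> v assume \<psi>: "\<psi> \<in> cball (0 :: 'v \<Rightarrow>\<^sub>L real) 1"
        \<comment> \<open>The difference of \<open>p\<close> and \<open>q\<close>, transported from the unit ball to the ball of radius \<open>r\<close>.\<close>
        let ?f = "\<lambda>\<phi>. r * (p (\<phi> /\<^sub>R r) v - q (\<phi> /\<^sub>R r) v)"
        have f: "bidual_on (2 * norm v) (cball 0 r) ?f"
          by (rule bidual_on_rescale[OF bidual_on_enveloping_difference[OF h pq[unfolded ws_def]] r(1)])
            (use r(1) in \<open>simp add: field_simps\<close>)
        have "p (y /\<^sub>R r) = q (y /\<^sub>R r)" if "y \<in> Y" for y
          using fun_cong[OF eq, of y] that r(1) by simp
        then have "?f \<phi> = 0" if "\<phi> \<in> Q" for \<phi>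
          by (intro vanish[OF f r(2) _ that]) simp
        moreover have "r *\<^sub>R \<psi> \<in> cball 0 r"
          using \<psi> r(1) by simp
        ultimately have "?f (r *\<^sub>R \<psi>) = 0"
          by (rule bidual_vanishes_on_closed_span[OF f _ r(2)]) (simp_all add: dense)
        then show "p \<psi> v = q \<psi> v"
          using r(1) by simp
      qed
    qed
    moreover have "dual_action h s \<phi> \<in> cball 0 1" if "\<phi> \<in> cball 0 1" for s \<phi>
    proof -
      have "norm (dual_action h s \<phi>) \<le> norm \<phi> * norm (h s)"
        unfolding dual_action_def by (rule norm_blinfun_compose)
      also have "\<dots> \<le> 1 * 1"
        using that h by (intro mult_mono) auto
      finally show ?thesis
        by simp
    qed
    moreover have "(\<lambda>x. x /\<^sub>R r) ` Y \<subseteq> cball 0 1"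
      using \<open>Y \<subseteq> Q\<close> r by (fastforce simp: field_simps)
    ultimately have "enveloping_iso (dual_action h) (subtopology ws (cball 0 1)) (subtopology ws Y)
        (\<lambda>p. \<lambda>x\<in>Y. r *\<^sub>R p (x /\<^sub>R r))"
      using inv homeomorphic_maps_weak_star_scale[OF r(1)]
      by (intro enveloping_iso_of_injective[OF Haus cball Y])
        (auto simp: ws_def linear_scale[OF linear_dual_action])
    moreover have "(\<lambda>p. restrict p Y) \<circ> (\<lambda>p. restrict p Q) \<circ> dilate r = (\<lambda>p. \<lambda>x\<in>Y. r *\<^sub>R p (x /\<^sub>R r))"
      using \<open>Y \<subseteq> Q\<close> r(2) by (auto simp: fun_eq_iff dilate_def restrict_def)
    ultimately show "enveloping_iso (dual_action h) (subtopology ws (cball 0 1)) (subtopology ws Y)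
        ((\<lambda>p. restrict p Y) \<circ> (\<lambda>p. restrict p Q) \<circ> dilate r)"
      by simp
  qed
  ultimately show ?thesis
    by blast
qed

end
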